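(* Let $P=[q]=\{0<1<\dots<q\}$, let $K$ be a finite filtered simplicial complex over $P$, $L$ a filtered simplicial complex over $P$, and $\phi:|K|_P\to|L|_P$ a stratum preserving continuous map. Then there exist a family $\Sigma=(\Sigma_p)_{p\in[q]}$ of natural numbers and a stratum preserving simplicial map $f:\mathrm{sd}^{\Sigma}(K)\to L$ such that $|f|_P$ is stratified homotopic to the composite $|\mathrm{sd}^\Sigma(K)|_P\xrightarrow{\cong}|K|_P\xrightarrow{\phi}|L|_P$, where the first map is the subdivision homeomorphism.
   Context: A filtered simplicial complex over a poset $P$ is a simplicial complex $K$ with a map $p_K:K^{(0)}\to P$ such that the image of every simplex is a chain in $P$; a stratum preserving simplicial map $f:K\to L$ is a simplicial map with $p_L\circ f=p_K$ on vertices. Its realization $|K|_P$ is the usual geometric realization (points $\sum t_x|x|$ in $\mathbb R^{K^{(0)}}$ supported on simplices) with the map to $P$ (Alexandroff topology, closed sets = down-sets) sending $\sum t_x|x|$ to $\max\{p_K(x):t_x>0\}$. A continuous map $\phi:|K|_P\to|L|_P$ is stratum preserving if it commutes with the maps to $P$; two such maps are stratified homotopic if there is a homotopy $H:|K|\times[0,1]\to|L|$ between them that is stratum preserving when $|K|\times[0,1]$ is filtered via the projection to $|K|_P$. For a full subcomplex $A\subset K$ let $K-A$ be the full subcomplex on vertices not in $A$. The relative barycentric subdivision $\mathrm{sd}(K\ \mathrm{rel}\ A)$ has vertex set $A^{(0)}\sqcup\{\text{nonempty simplices of }K-A\}$ and simplices $\sigma\cup\{\tau_0\subsetneq\dots\subsetneq\tau_k\}$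 with $\sigma\in A$, $\tau_i\in K-A$ and $\sigma\cup\tau_k\in K$; it is filtered by $a\mapsto p_K(a)$ for $a\in A^{(0)}$ and $\tau\mapsto\max p_K(\tau)$, and it is a subdivision of $K$ via $a\mapsto|a|$, $\tau\mapsto$ barycenter of $|\tau|$ (no new vertices on $|A|$). Iterating $m$ times (always relative to the subdivided copy of $A$) gives $\mathrm{sd}^m(K\ \mathrm{rel}\ A)$. For $P=[q]$, $K_{\le p}$ denotes the full subcomplex on vertices with $p_K\le p$. For $\Sigma=(\Sigma_p)_{p\in[q]}$ define inductively $\mathrm{sd}^{\Sigma_{\le-1}}(K)=K$ and $\mathrm{sd}^{\Sigma_{\le p+1}}(K)=\mathrm{sd}^{\Sigma_{p+1}}\big(\mathrm{sd}^{\Sigma_{\le p}}(K)\ \mathrm{rel}\ \mathrm{sd}^{\Sigma_{\le p}}(K)_{\le p}\big)$ (with $K_{\le -1}=\emptyset$), and $\mathrm{sd}^\Sigma(K)=\mathrm{sd}^{\Sigma_{\le q}}(K)$; it comes with the composite subdivision homeomorphism $|\mathrm{sd}^\Sigma(K)|_P\cong|K|_P$, which is stratum preserving. *)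

theory Defs
  imports "HOL-Analysis.Analysis" "HOL-Library.FSet"
begin

definition simplicial_complex :: "'a set set \<Rightarrow> bool" where
  "simplicial_complex K \<longleftrightarrow>
     (\<forall>\<sigma>\<in>K. finite \<sigma> \<and> \<sigma> \<noteq> {}) \<and> (\<forall>\<sigma>\<in>K. \<forall>\<tau>. \<tau> \<subseteq> \<sigma> \<and> \<tau> \<noteq> {} \<longrightarrow> \<tau> \<in> K)"

text \<open>Filtered over [q] = {0<1<...<q}: vertices are mapped into {0..q};
  images of simplices are automatically chains since [q] is totally ordered.\<close>

definition filtered_complex :: "nat \<Rightarrow> 'a set set \<Rightarrow> ('a \<Rightarrow> nat) \<Rightarrow> bool" where
  "filtered_complex q K p \<longleftrightarrow> simplicial_complex K \<and> (\<forall>v\<in>\<Union>K. p v \<le> q)"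

definition simplicial_map_strat ::
  "'a set set \<Rightarrow> ('a \<Rightarrow> nat) \<Rightarrow> 'b set set \<Rightarrow> ('b \<Rightarrow> nat) \<Rightarrow> ('a \<Rightarrow> 'b) \<Rightarrow> bool" where
  "simplicial_map_strat K pK L pL f \<longleftrightarrow>
     (\<forall>\<sigma>\<in>K. f ` \<sigma> \<in> L) \<and> (\<forall>v\<in>\<Union>K. pL (f v) = pK v)"

definition realization :: "'a set set \<Rightarrow> ('a \<Rightarrow> real) set" where
  "realization K = {t. (\<forall>v. 0 \<le> t v) \<and> {v. t v \<noteq> 0} \<in> K \<and> sum t {v. t v \<noteq> 0} = 1}"

definition closed_simplex :: "'a set \<Rightarrow> ('a \<Rightarrow> real) set" where
  "closed_simplex \<sigma> = {t. (\<forall>v. 0 \<le> t v) \<and> (\<forall>v. v \<notin> \<sigma> \<longrightarrow> t v = 0) \<and> sum t \<sigma> = 1}"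

definition realization_top :: "'a set set \<Rightarrow> ('a \<Rightarrow> real) topology" where
  "realization_top K = topology (\<lambda>U. U \<subseteq> realization K \<and>
      (\<forall>\<sigma>\<in>K. openin (top_of_set (closed_simplex \<sigma>)) (U \<inter> closed_simplex \<sigma>)))"

definition strat :: "('a \<Rightarrow> nat) \<Rightarrow> ('a \<Rightarrow> real) \<Rightarrow> nat" where
  "strat p t = Max (p ` {v. t v \<noteq> 0})"

definition real_map :: "('a \<Rightarrow> 'b) \<Rightarrow> ('a \<Rightarrow> real) \<Rightarrow> ('b \<Rightarrow> real)" where
  "real_map f t = (\<lambda>u. \<Sum>w\<in>{w. t w \<noteq> 0 \<and> f w = u}. t w)"

definition strat_map ::
  "'a set set \<Rightarrow> ('a \<Rightarrow> nat) \<Rightarrow> 'b set set \<Rightarrow> ('b \<Rightarrow> nat)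
     \<Rightarrow> (('a \<Rightarrow> real) \<Rightarrow> ('b \<Rightarrow> real)) \<Rightarrow> bool" where
  "strat_map K pK L pL g \<longleftrightarrow>
     continuous_map (realization_top K) (realization_top L) g \<and>
     (\<forall>x\<in>realization K. strat pL (g x) = strat pK x)"

definition strat_homotopic ::
  "'a set set \<Rightarrow> ('a \<Rightarrow> nat) \<Rightarrow> 'b set set \<Rightarrow> ('b \<Rightarrow> nat)
     \<Rightarrow> (('a \<Rightarrow> real) \<Rightarrow> ('b \<Rightarrow> real)) \<Rightarrow> (('a \<Rightarrow> real) \<Rightarrow> ('b \<Rightarrow> real)) \<Rightarrow> bool" where
  "strat_homotopic K pK L pL g0 g1 \<longleftrightarrow>
     (\<exists>H. continuous_map (prod_topology (realization_top K) (top_of_set {0..1::real}))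
            (realization_top L) H \<and>
          (\<forall>x\<in>realization K. \<forall>s\<in>{0..1::real}. strat pL (H (x, s)) = strat pK x) \<and>
          (\<forall>x\<in>realization K. H (x, 0) = g0 x \<and> H (x, 1) = g1 x))"

text \<open>Vertices of iterated subdivisions: original vertices, and (new) vertices
  standing for simplices of the previous complex.\<close>

datatype 'v sdv = Orig 'v | Bary "'v sdv fset"

text \<open>A filtered complex together with the position of each vertex in the
  realization of the original complex (this records the composite subdivision
  homeomorphism, which is linear on simplices).\<close>

type_synonym 'v fcx = "'v sdv set set \<times> ('v sdv \<Rightarrow> nat) \<times> ('v sdv \<Rightarrow> 'v \<Rightarrow> real)"

text \<open>sd(K rel A) where A is the full subcomplex of K on the vertex set Av.
  Simplices: sigma \<union> {tau_0 \<subset> ... \<subset> tau_k}, sigma in A, tau_i in K - A,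
  sigma \<union> tau_k in K.\<close>

definition sd_rel :: "'v sdv set set \<Rightarrow> 'v sdv set \<Rightarrow> 'v sdv set set" where
  "sd_rel K Av = {S \<union> (\<lambda>\<tau>. Bary (Abs_fset \<tau>)) ` T | S T.
      S \<subseteq> Av \<and> finite T \<and> (\<forall>\<tau>\<in>T. \<tau> \<in> K \<and> \<tau> \<inter> Av = {}) \<and>
      (\<forall>\<tau>1\<in>T. \<forall>\<tau>2\<in>T. \<tau>1 \<subseteq> \<tau>2 \<or> \<tau>2 \<subseteq> \<tau>1) \<and> S \<union> \<Union>T \<in> K}"

definition sd_step :: "'v fcx \<Rightarrow> 'v sdv set \<Rightarrow> 'v fcx" where
  "sd_step X Av = (case X of (K, p, pos) \<Rightarrow>
     (sd_rel K Av,
      \<lambda>w. if w \<in> Av then p w else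
             (case w of Bary \<tau> \<Rightarrow> Max (p ` fset \<tau>) | Orig v \<Rightarrow> p w),
      \<lambda>w. if w \<in> Av then pos w else
             (case w of Bary \<tau> \<Rightarrow> (\<lambda>u. (\<Sum>x\<in>fset \<tau>. pos x u) / real (card (fset \<tau>)))
                      | Orig v \<Rightarrow> pos w)))"

definition low_verts :: "nat \<Rightarrow> 'v fcx \<Rightarrow> 'v sdv set" where
  "low_verts j X = (case X of (K, p, pos) \<Rightarrow> {w \<in> \<Union>K. p w \<le> j})"

text \<open>sd^{Sigma_{<= j}}(K); the first step (j = 0) is relative to K_{<= -1} = empty.\<close>

fun sd_Sigma :: "(nat \<Rightarrow> nat) \<Rightarrow> nat \<Rightarrow> 'v fcx \<Rightarrow> 'v fcx" where
  "sd_Sigma \<Sigma> 0 X = ((\<lambda>Y. sd_step Y {}) ^^ \<Sigma> 0) X"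
| "sd_Sigma \<Sigma> (Suc j) X =
     ((\<lambda>Y. sd_step Y (low_verts j (sd_Sigma \<Sigma> j X))) ^^ \<Sigma> (Suc j)) (sd_Sigma \<Sigma> j X)"

definition init_fcx :: "'v set set \<Rightarrow> ('v \<Rightarrow> nat) \<Rightarrow> 'v fcx" where
  "init_fcx K p =
     ((\<lambda>\<sigma>. Orig ` \<sigma>) ` K,
      \<lambda>w. case w of Orig v \<Rightarrow> p v | Bary _ \<Rightarrow> 0,
      \<lambda>w. case w of Orig v \<Rightarrow> (\<lambda>u. if u = v then 1 else 0) | Bary _ \<Rightarrow> (\<lambda>u. 0))"

definition subdiv_homeo :: "('v sdv \<Rightarrow> 'v \<Rightarrow> real) \<Rightarrow> ('v sdv \<Rightarrow> real) \<Rightarrow> ('v \<Rightarrow> real)" where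
  "subdiv_homeo pos t = (\<lambda>u. \<Sum>w\<in>{w. t w \<noteq> 0}. t w * pos w u)"

end

theory Submission
  imports Defs
begin

text \<open>Suppose that \<open>f\<close> assigns to every vertex \<open>v\<close> of a subdivision \<open>S\<close> a vertex of the same stratum
  such that \<open>g = \<phi> \<circ> subdiv_homeo\<close> maps the open star of \<open>v\<close> within the full subcomplex on the strata
  \<open>\<ge> pS v\<close> into the open star of \<open>f v\<close>. Unlike the star condition for all of \<open>S\<close>, this can be
  reached by subdivisions that leave the lower strata fixed, and it still implies that \<open>f\<close> is simplicial
  and that \<open>g\<close> can be deformed into the realization of \<open>f\<close>, one stratum at a time.

  For stratum \<open>j\<close> the condition is obtained from a Lebesgue number: during stage \<open>j\<close> the vertices of
  stratum \<open>j\<close> stay at points of \<open>K\<close> at which the weights of the vertices of stratum \<open>j\<close> sum up to at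
  least \<open>\<epsilon>\<close>, which form a compact subset of that stratum, while the simplices off the lower strata
  shrink. Only the positions of adjacent vertices matter, so the condition survives the later stages.\<close>

section \<open>Realizations\<close>

text \<open>The obstacle is that a stratum is in general not compact. Towards the lower strata, the
  region on which \<open>\<phi>\<close> keeps a given coordinate nonzero can become arbitrarily
  thin, and full barycentric subdivision keeps creating vertices of stratum \<open>j\<close> ever
  closer to the lower strata, so the search for an ordinary star condition need never end. Relative
  to the lower strata, a new vertex of stratum \<open>j\<close> is an average of vertices of stratum
  \<open>j\<close> only, which is why the bound \<open>\<epsilon>\<close> survives. The price is
  that simplices meeting the lower strata need not become small; the restriction of the star to the
  strata \<ge> \<open>pS v\<close> pays exactly this price. Since \<open>\<epsilon>\<close> is read
  off the complex at which stage \<open>j\<close> starts, the numbers \<open>\<Sigma> j\<close> are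
  chosen successively, each depending on the earlier ones. A separate matter is that
  \<open>L\<close> may be infinite. The image of \<open>\<phi>\<close> is compact and meets only
  finitely many open simplices, so \<open>L\<close> is cut down to a finite subcomplex, where the
  weak topology is that of pointwise convergence and continuity can be checked in each
  coordinate.\<close>

abbreviation supp :: "('a \<Rightarrow> real) \<Rightarrow> 'a set" where
  "supp t \<equiv> {v. t v \<noteq> 0}"

lemma realizationI:
  "\<lbrakk>\<And>v. 0 \<le> t v; supp t \<in> K; sum t (supp t) = 1\<rbrakk> \<Longrightarrow> t \<in> realization K"
  by (simp add: realization_def)

lemma realizationD:
  assumes "t \<in> realization K"
  shows "0 \<le> t v" "supp t \<in> K" "sum t (supp t) = 1"
  using assms by (auto simp: realization_def)

lemma realization_mono: "K \<subseteq> K' \<Longrightarrow> realization K \<subseteq> realization K'"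
  by (auto simp: realization_def)

lemma simplicial_complexD:
  assumes "simplicial_complex K" "\<sigma> \<in> K"
  shows "finite \<sigma>" "\<sigma> \<noteq> {}" "\<tau> \<subseteq> \<sigma> \<Longrightarrow> \<tau> \<noteq> {} \<Longrightarrow> \<tau> \<in> K"
  using assms unfolding simplicial_complex_def by blast+

lemma sum_supp:
  assumes "finite \<sigma>" "supp t \<subseteq> \<sigma>"
  shows "sum t (supp t) = sum t \<sigma>"
  using assms by (intro sum.mono_neutral_left) auto

lemma realization_finite_supp:
  assumes "simplicial_complex K" "t \<in> realization K"
  shows "finite (supp t)" "supp t \<noteq> {}" "supp t \<subseteq> \<Union>K"
  using simplicial_complexD(1,2)[OF assms(1) realizationD(2)[OF assms(2)]] realizationD(2)[OF assms(2)]
  by auto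

lemma realization_sum_eq_1:
  assumes "t \<in> realization K" "finite \<sigma>" "supp t \<subseteq> \<sigma>"
  shows "sum t \<sigma> = 1"
  using sum_supp[OF assms(2,3)] realizationD(3)[OF assms(1)] by simp

lemma realization_le_1:
  assumes "simplicial_complex K" "t \<in> realization K"
  shows "t v \<le> 1"
proof (cases "v \<in> supp t")
  case True
  have "t v \<le> sum t (supp t)"
    by (rule member_le_sum[OF True]) (use realization_finite_supp[OF assms] realizationD[OF assms(2)] in auto)
  then show ?thesis using realizationD[OF assms(2)] by simp
qed simp

lemma closed_simplex_subset_realization:
  assumes "simplicial_complex K" "\<sigma> \<in> K"
  shows "closed_simplex \<sigma> \<subseteq> realization K"
proof
  fix t assume t: "t \<in> closed_simplex \<sigma>"
  have fin: "finite \<sigma>" using assms by (auto simp: simplicial_complex_def)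
  have sub: "supp t \<subseteq> \<sigma>" using t by (auto simp: closed_simplex_def)
  have s: "sum t (supp t) = 1" using sum_supp[OF fin sub] t by (simp add: closed_simplex_def)
  then have "supp t \<noteq> {}" by force
  then have "supp t \<in> K" using simplicial_complexD(3)[OF assms sub] by simp
  then show "t \<in> realization K"
    using t s by (auto simp: closed_simplex_def intro: realizationI)
qed

lemma realization_in_closed_simplex:
  assumes "t \<in> realization K" "finite \<sigma>" "supp t \<subseteq> \<sigma>"
  shows "t \<in> closed_simplex \<sigma>"
  using realization_sum_eq_1[OF assms] realizationD[OF assms(1)] assms(3)
  by (auto simp: closed_simplex_def)

lemma realization_eq_Union:
  assumes "simplicial_complex K"
  shows "realization K = (\<Union>\<sigma>\<in>K. closed_simplex \<sigma>)"
proof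
  show "realization K \<subseteq> (\<Union>\<sigma>\<in>K. closed_simplex \<sigma>)"
  proof
    fix t assume t: "t \<in> realization K"
    show "t \<in> (\<Union>\<sigma>\<in>K. closed_simplex \<sigma>)"
      using realization_in_closed_simplex[OF t realization_finite_supp(1)[OF assms t] subset_refl]
        realizationD(2)[OF t] by blast
  qed
  show "(\<Union>\<sigma>\<in>K. closed_simplex \<sigma>) \<subseteq> realization K"
    using closed_simplex_subset_realization[OF assms] by blast
qed

section \<open>Weak topology and product topology on a realization\<close>

lemma closed_closed_simplex: "closed (closed_simplex (\<sigma> :: 'a set))"
proof -
  have "closed_simplex \<sigma> =
    (\<Inter>v. {t. 0 \<le> t v}) \<inter> (\<Inter>v\<in>-\<sigma>. {t. t v = 0}) \<inter> {t. sum t \<sigma> = 1}"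
    by (auto simp: closed_simplex_def)
  also have "closed \<dots>"
    by (intro closed_Int closed_INT ballI closed_Collect_le closed_Collect_eq)
      (auto intro!: continuous_intros continuous_on_product_coordinates)
  finally show ?thesis .
qed

lemma compact_closed_simplex:
  assumes "finite \<sigma>"
  shows "compact (closed_simplex (\<sigma> :: 'a set))"
proof -
  have "compactin (product_topology (\<lambda>i::'a. euclidean :: real topology) UNIV) (PiE UNIV (\<lambda>_. {0..1}))"
    by (simp add: compactin_PiE)
  then have c: "compact (PiE UNIV (\<lambda>_::'a. {0..1::real}))"
    by (simp add: euclidean_product_topology)
  have "t v \<le> 1" if "t \<in> closed_simplex \<sigma>" for t :: "'a \<Rightarrow> real" and v
  proof (cases "v \<in> \<sigma>")
    case True
    have "t v \<le> sum t \<sigma>"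
      by (rule member_le_sum[OF True]) (use that assms in \<open>auto simp: closed_simplex_def\<close>)
    then show ?thesis using that by (simp add: closed_simplex_def)
  next
    case False then show ?thesis using that by (simp add: closed_simplex_def)
  qed
  then have "closed_simplex \<sigma> = PiE UNIV (\<lambda>_. {0..1}) \<inter> closed_simplex \<sigma>"
    by (auto simp: closed_simplex_def)
  then show ?thesis
    using compact_Int_closed[OF c closed_closed_simplex] by metis
qed

lemma compact_realization:
  assumes "simplicial_complex K" "finite K"
  shows "compact (realization K)"
  unfolding realization_eq_Union[OF assms(1)]
  by (intro compact_UN assms(2) ballI compact_closed_simplex simplicial_complexD(1)[OF assms(1)])

text \<open>\<open>topology\<close> returns the given open sets only if they form a topology; this
  is verified here once, for arbitrary \<open>K\<close>.\<close>

lemma openin_realization_top: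
  "openin (realization_top K) U \<longleftrightarrow> U \<subseteq> realization K \<and>
      (\<forall>\<sigma>\<in>K. openin (top_of_set (closed_simplex \<sigma>)) (U \<inter> closed_simplex \<sigma>))"
proof -
  have "istopology (\<lambda>U. U \<subseteq> realization K \<and>
      (\<forall>\<sigma>\<in>K. openin (top_of_set (closed_simplex \<sigma>)) (U \<inter> closed_simplex \<sigma>)))"
    unfolding istopology_def
  proof (intro conjI allI impI ballI; (elim conjE)?)
    fix S T \<sigma>
    assume "\<forall>\<sigma>\<in>K. openin (top_of_set (closed_simplex \<sigma>)) (S \<inter> closed_simplex \<sigma>)"
      "\<forall>\<sigma>\<in>K. openin (top_of_set (closed_simplex \<sigma>)) (T \<inter> closed_simplex \<sigma>)" "\<sigma> \<in> K"
    then have "openin (top_of_set (closed_simplex \<sigma>)) ((S \<inter> closed_simplex \<sigma>) \<inter> (T \<inter> closed_simplex \<sigma>))"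
      by (intro openin_Int[of _ "S \<inter> closed_simplex \<sigma>"]) auto
    moreover have "S \<inter> T \<inter> closed_simplex \<sigma> = (S \<inter> closed_simplex \<sigma>) \<inter> (T \<inter> closed_simplex \<sigma>)"
      by auto
    ultimately show "openin (top_of_set (closed_simplex \<sigma>)) (S \<inter> T \<inter> closed_simplex \<sigma>)"
      by (simp only:)
  next
    fix \<K> \<sigma>
    assume "\<forall>U\<in>\<K>. U \<subseteq> realization K \<and> (\<forall>\<sigma>\<in>K. openin (top_of_set (closed_simplex \<sigma>)) (U \<inter> closed_simplex \<sigma>))"
      "\<sigma> \<in> K"
    then have "openin (top_of_set (closed_simplex \<sigma>)) (\<Union>U\<in>\<K>. U \<inter> closed_simplex \<sigma>)"
      by (intro openin_Union) auto
    moreover have "\<Union>\<K> \<inter> closed_simplex \<sigma> = (\<Union>U\<in>\<K>. U \<inter> closed_simplex \<sigma>)"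
      by blast
    ultimately show "openin (top_of_set (closed_simplex \<sigma>)) (\<Union>\<K> \<inter> closed_simplex \<sigma>)"
      by (simp only:)
  qed blast+
  then show ?thesis
    by (simp add: realization_top_def)
qed

lemma topspace_realization_top [simp]:
  assumes "simplicial_complex K"
  shows "topspace (realization_top K) = realization K"
proof
  show "topspace (realization_top K) \<subseteq> realization K"
    using openin_realization_top openin_topspace by blast
  have "openin (realization_top K) (realization K)"
    using closed_simplex_subset_realization[OF assms]
    by (auto simp: openin_realization_top Int_absorb1)
  then show "realization K \<subseteq> topspace (realization_top K)"
    by (rule openin_subset)
qed

lemma openin_realization_top_open:
  assumes "simplicial_complex K" "open U"
  shows "openin (realization_top K) (realization K \<inter> U)"
proof -
  have "realization K \<inter> U \<inter> closed_simplex \<sigma> = closed_simplex \<sigma> \<inter> U" if "\<sigma> \<in> K" for \<sigma>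
    using closed_simplex_subset_realization[OF assms(1) that] by auto
  then show ?thesis
    using assms(2) by (auto simp: openin_realization_top openin_open)
qed

text \<open>The complement of a weakly open set is a finite union of closed sets, one in each closed
  simplex. From here on, finite complexes are treated with \<open>continuous_on\<close>.\<close>

lemma realization_top_finite:
  assumes "simplicial_complex K" "finite K"
  shows "realization_top K = top_of_set (realization K)"
proof -
  have "openin (realization_top K) U \<longleftrightarrow> openin (top_of_set (realization K)) U" for U
  proof
    assume U: "openin (realization_top K) U"
    have "closed (closed_simplex \<sigma> - U)" if "\<sigma> \<in> K" for \<sigma>
    proof -
      have "openin (top_of_set (closed_simplex \<sigma>)) (U \<inter> closed_simplex \<sigma>)"
        using U that by (simp add: openin_realization_top)
      then obtain W where W: "open W" "U \<inter> closed_simplex \<sigma> = closed_simplex \<sigma> \<inter> W"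
        by (auto simp: openin_open)
      have "closed_simplex \<sigma> - U = closed_simplex \<sigma> \<inter> - W"
        using W(2) by auto
      then show ?thesis
        using W(1) by (simp add: closed_Int closed_closed_simplex closed_Compl)
    qed
    then have "closed (\<Union>\<sigma>\<in>K. closed_simplex \<sigma> - U)"
      by (intro closed_UN assms(2) ballI)
    moreover have "U = realization K \<inter> - (\<Union>\<sigma>\<in>K. closed_simplex \<sigma> - U)"
    proof -
      have "U \<subseteq> (\<Union>\<sigma>\<in>K. closed_simplex \<sigma>)"
        using U by (simp add: openin_realization_top realization_eq_Union[OF assms(1)])
      then show ?thesis
        unfolding realization_eq_Union[OF assms(1)] by auto
    qed
    ultimately show "openin (top_of_set (realization K)) U"
      unfolding openin_open using open_Compl by blast
  next
    assume "openin (top_of_set (realization K)) U"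
    then show "openin (realization_top K) U"
      using openin_realization_top_open[OF assms(1)] by (auto simp: openin_open)
  qed
  then show ?thesis by (simp add: topology_eq)
qed

lemma continuous_map_realization_id:
  assumes "simplicial_complex K"
  shows "continuous_map (realization_top K) (top_of_set (realization K)) (\<lambda>x. x)"
  unfolding continuous_map_def
proof (intro conjI allI impI)
  show "(\<lambda>x. x) \<in> topspace (realization_top K) \<rightarrow> topspace (top_of_set (realization K))"
    using assms by simp
  fix U assume "openin (top_of_set (realization K)) U"
  then obtain W where W: "open W" "U = realization K \<inter> W"
    by (auto simp: openin_open)
  then have "{x \<in> topspace (realization_top K). x \<in> U} = realization K \<inter> W"
    using assms by auto
  then show "openin (realization_top K) {x \<in> topspace (realization_top K). x \<in> U}"
    using openin_realization_top_open[OF assms W(1)] by (simp only:)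
qed

lemma continuous_map_realization_mono:
  assumes "simplicial_complex K" "simplicial_complex L" "K \<subseteq> L"
  shows "continuous_map (realization_top K) (realization_top L) (\<lambda>x. x)"
  unfolding continuous_map_def
proof (intro conjI allI impI)
  show "(\<lambda>x. x) \<in> topspace (realization_top K) \<rightarrow> topspace (realization_top L)"
    using assms realization_mono by auto
  fix U assume U: "openin (realization_top L) U"
  have "{x \<in> realization K. x \<in> U} \<inter> closed_simplex \<sigma> = U \<inter> closed_simplex \<sigma>" if "\<sigma> \<in> K" for \<sigma>
    using closed_simplex_subset_realization[OF assms(1) that] by auto
  then show "openin (realization_top K) {x \<in> topspace (realization_top K). x \<in> U}"
    using U assms by (auto simp: openin_realization_top)
qed

text \<open>The weak topology is finer than the product topology, so a map into a possibly infinite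
  \<open>L\<close> stays continuous for pointwise convergence.
  \<open>continuous_map_realizationI\<close> is the way back, for finite \<open>L\<close>.\<close>

lemma continuous_on_realization_map:
  assumes "simplicial_complex K" "finite K" "simplicial_complex L"
    and "continuous_map (realization_top K) (realization_top L) g"
  shows "continuous_on (realization K) g" "g ` realization K \<subseteq> realization L"
proof -
  have "continuous_map (top_of_set (realization K)) (top_of_set (realization L)) ((\<lambda>x. x) \<circ> g)"
    using continuous_map_compose[OF assms(4) continuous_map_realization_id[OF assms(3)]]
    by (simp add: realization_top_finite[OF assms(1,2)])
  then show "continuous_on (realization K) g" "g ` realization K \<subseteq> realization L"
    by (auto simp: comp_def)
qed

lemma continuous_map_realizationI:
  assumes "simplicial_complex L" "finite L"
    and "continuous_on S g" "g ` S \<subseteq> realization L"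
  shows "continuous_map (top_of_set S) (realization_top L) g"
  using assms by (auto simp: realization_top_finite continuous_map_in_subtopology)

section \<open>Compact sets meet only finitely many open simplices\<close>

lemma closed_singleton_fun: "closed {d :: 'a \<Rightarrow> real}"
proof -
  have "{d} = (\<Inter>v. {t. t v = d v})" by auto
  also have "closed \<dots>"
    by (intro closed_INT ballI closed_Collect_eq) (auto intro!: continuous_intros continuous_on_product_coordinates)
  finally show ?thesis .
qed

text \<open>A finite simplex has only finitely many subsets that could be supports, so every closed
  simplex meets \<open>D\<close> in finitely many points.\<close>

lemma closedin_realization_top_distinct_supp:
  assumes "simplicial_complex L" "D \<subseteq> realization L" "inj_on supp D"
  shows "closedin (realization_top L) (D :: ('a \<Rightarrow> real) set)"
proof -
  have "openin (top_of_set (closed_simplex \<sigma>)) ((realization L - D) \<inter> closed_simplex \<sigma>)"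
    if "\<sigma> \<in> L" for \<sigma>
  proof -
    have "supp t \<subseteq> \<sigma>" if "t \<in> closed_simplex \<sigma>" for t :: "'a \<Rightarrow> real"
      using that by (auto simp: closed_simplex_def)
    then have "supp ` (D \<inter> closed_simplex \<sigma>) \<subseteq> Pow \<sigma>"
      by blast
    then have "finite (supp ` (D \<inter> closed_simplex \<sigma>))"
      using simplicial_complexD(1)[OF assms(1) that] by (simp add: finite_subset)
    then have "finite (D \<inter> closed_simplex \<sigma>)"
      by (rule finite_imageD) (rule inj_on_subset[OF assms(3)], simp)
    then have "closed (\<Union>d\<in>D \<inter> closed_simplex \<sigma>. {d})"
      by (intro closed_UN) (auto intro: closed_singleton_fun)
    then have "closed (D \<inter> closed_simplex \<sigma>)"
      by simp
    then have "open (- (D \<inter> closed_simplex \<sigma>))"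
      by (rule open_Compl)
    moreover have "(realization L - D) \<inter> closed_simplex \<sigma> = closed_simplex \<sigma> \<inter> - (D \<inter> closed_simplex \<sigma>)"
      using closed_simplex_subset_realization[OF assms(1) that] by auto
    ultimately show ?thesis unfolding openin_open by blast
  qed
  then have "openin (realization_top L) (realization L - D)"
    by (simp add: openin_realization_top)
  then show ?thesis
    using assms(1,2) by (simp add: closedin_def)
qed

text \<open>Choose one point of \<open>C\<close> for each support. All subsets of the resulting set
  \<open>D\<close> are closed, so \<open>D\<close> is closed and discrete inside a compact set,
  hence finite.\<close>

lemma finite_supp_compactin:
  assumes L: "simplicial_complex L" and C: "compactin (realization_top L) C"
  shows "finite (supp ` C)"
proof -
  obtain D where D: "D \<subseteq> C" "inj_on supp D" "supp ` C = supp ` D"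
    using subset_image_inj[of "supp ` C" supp C] by auto
  have CL: "C \<subseteq> realization L"
    using compactin_subset_topspace[OF C] L by simp
  have cl: "closedin (realization_top L) E" if "E \<subseteq> D" for E
    using closedin_realization_top_distinct_supp[OF L, of E] that D(1,2) CL
    by (meson inj_on_subset order_trans)
  have "compactin (realization_top L) D"
    by (rule closed_compactin[OF C D(1) cl]) simp
  moreover have "openin (subtopology (realization_top L) D) E" if "E \<subseteq> D" for E
  proof -
    have "E = (topspace (realization_top L) - (D - E)) \<inter> D"
      using that D(1) CL topspace_realization_top[OF L] by blast
    moreover have "openin (realization_top L) (topspace (realization_top L) - (D - E))"
      using cl[of "D - E"] by blast
    ultimately show ?thesis unfolding openin_subtopology by blast
  qed
  moreover have "topspace (subtopology (realization_top L) D) = D"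
    using D(1) CL topspace_realization_top[OF L] by auto
  ultimately have "discrete_topology D = subtopology (realization_top L) D" "compactin (realization_top L) D"
    unfolding discrete_topology_unique by simp_all
  then have "compact_space (discrete_topology D)"
    by (simp add: compactin_subspace)
  then have "finite D"
    by (simp add: compact_space_discrete_topology)
  then show ?thesis by (simp add: D(3))
qed

section \<open>Deforming a map to a simplicial map\<close>

text \<open>Made for the product of \<open>mass p\<close> and a coordinate of
  \<open>g (rest p)\<close>: the second factor need not have a limit where the mass tends to zero,
  but it is bounded, so the vanishing factor absorbs it.\<close>

lemma continuous_on_mult_vanishing:
  fixes N G :: "'a::topological_space \<Rightarrow> real"
  assumes N: "continuous_on D N" and G: "continuous_on {p \<in> D. N p \<noteq> 0} G"
    and bd: "\<And>p. p \<in> D \<Longrightarrow> N p \<noteq> 0 \<Longrightarrow> \<bar>G p\<bar> \<le> 1"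
  shows "continuous_on D (\<lambda>p. N p * G p)"
  unfolding continuous_on_def
proof
  fix p assume p: "p \<in> D"
  show "((\<lambda>p. N p * G p) \<longlongrightarrow> N p * G p) (at p within D)"
  proof (cases "N p = 0")
    case True
    have "((\<lambda>p. \<bar>N p\<bar>) \<longlongrightarrow> \<bar>N p\<bar>) (at p within D)"
      using N p by (intro tendsto_rabs) (simp add: continuous_on_def)
    then have lim: "((\<lambda>p. \<bar>N p\<bar>) \<longlongrightarrow> 0) (at p within D)"
      using True by simp
    have "\<forall>\<^sub>F y in at p within D. norm (N y * G y) \<le> \<bar>N y\<bar>"
    proof (rule eventually_mono)
      show "\<forall>\<^sub>F y in at p within D. y \<in> D"
        by (simp add: eventually_at_filter)
      fix y assume "y \<in> D"
      then show "norm (N y * G y) \<le> \<bar>N y\<bar>"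
        using bd[of y] by (cases "N y = 0") (simp_all add: abs_mult mult_left_le)
    qed
    then have "((\<lambda>y. N y * G y) \<longlongrightarrow> 0) (at p within D)"
      by (rule Lim_null_comparison[OF _ lim])
    then show ?thesis using True by simp
  next
    case False
    \<comment> \<open>\<open>N p \<noteq> 0\<close> is an open condition in \<open>D\<close>, so
      limits taken within the set where it holds are limits within \<open>D\<close>.\<close>
    obtain W where W: "open W" "D \<inter> N -` (- {0}) = D \<inter> W"
      using N open_Compl[OF closed_singleton[of "0::real"]] unfolding continuous_on_open_invariant
      by (metis Int_commute)
    then have E: "{p \<in> D. N p \<noteq> 0} = D \<inter> W" by blast
    have "p \<in> W" using p False E by blast
    have "continuous_on {p \<in> D. N p \<noteq> 0} (\<lambda>p. N p * G p)"
      by (intro continuous_on_mult continuous_on_subset[OF N] G) auto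
    then have "((\<lambda>p. N p * G p) \<longlongrightarrow> N p * G p) (at p within D \<inter> W)"
      using p \<open>p \<in> W\<close> unfolding E continuous_on_def by blast
    moreover have "at p within D \<inter> W = at p within D"
      by (rule at_within_nhd[OF \<open>p \<in> W\<close> W(1)]) auto
    ultimately show ?thesis by simp
  qed
qed

text \<open>A point whose support is all of \<open>\<sigma>\<close>. It serves as a test point in
  the open simplex and, through \<open>subdiv_homeo\<close>, as the position of a new
  vertex.\<close>

definition barycenter :: "'a set \<Rightarrow> 'a \<Rightarrow> real" where
  "barycenter \<sigma> = (\<lambda>v. if v \<in> \<sigma> then 1 / real (card \<sigma>) else 0)"

lemma supp_barycenter: "finite \<sigma> \<Longrightarrow> supp (barycenter \<sigma>) = \<sigma>"
  by (auto simp: barycenter_def)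

lemma barycenter_in_realization:
  assumes "simplicial_complex K" "\<sigma> \<in> K"
  shows "barycenter \<sigma> \<in> realization K"
proof (rule realizationI)
  note s = simplicial_complexD[OF assms]
  show "0 \<le> barycenter \<sigma> v" for v by (simp add: barycenter_def)
  show "supp (barycenter \<sigma>) \<in> K" using s assms by (simp add: supp_barycenter)
  show "sum (barycenter \<sigma>) (supp (barycenter \<sigma>)) = 1"
    using s(1,2) unfolding supp_barycenter[OF s(1)] by (simp add: barycenter_def)
qed

lemma convex_comb_in_realization:
  assumes K: "simplicial_complex K" and "x \<in> realization K" "y \<in> realization K"
    and "supp x \<union> supp y \<in> K" and e: "0 \<le> e" "e \<le> (1::real)"
  shows "(\<lambda>v. (1 - e) * x v + e * y v) \<in> realization K"
proof -
  let ?z = "\<lambda>v. (1 - e) * x v + e * y v"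
  have fin: "finite (supp x \<union> supp y)"
    using simplicial_complexD(1)[OF K assms(4)] .
  have nn: "0 \<le> ?z v" for v
    using realizationD(1)[OF assms(2)] realizationD(1)[OF assms(3)] e by simp
  have "sum x (supp x \<union> supp y) = 1" "sum y (supp x \<union> supp y) = 1"
    using fin by (auto intro!: realization_sum_eq_1 assms)
  then have "sum ?z (supp x \<union> supp y) = 1"
    by (simp add: sum.distrib flip: sum_distrib_left)
  moreover have "v \<notin> supp x \<union> supp y \<longrightarrow> ?z v = 0" for v
    by simp
  ultimately have "?z \<in> closed_simplex (supp x \<union> supp y)"
    using nn unfolding closed_simplex_def by blast
  then show ?thesis
    using closed_simplex_subset_realization[OF K assms(4)] by blast
qed

locale approximation =
  fixes q :: nat and S :: "'a set set" and pS :: "'a \<Rightarrow> nat"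
    and L :: "'b set set" and pL :: "'b \<Rightarrow> nat"
    and g :: "('a \<Rightarrow> real) \<Rightarrow> 'b \<Rightarrow> real" and f :: "'a \<Rightarrow> 'b"
  assumes S: "simplicial_complex S" "finite S"
    and L: "simplicial_complex L" "finite L"
    and pS_le: "\<And>v. v \<in> \<Union>S \<Longrightarrow> pS v \<le> q"
    and cont_g: "continuous_on (realization S) g"
    and g_in: "\<And>x. x \<in> realization S \<Longrightarrow> g x \<in> realization L"
    and strat_g: "\<And>x. x \<in> realization S \<Longrightarrow> strat pL (g x) = strat pS x"
    and strat_f: "\<And>v. v \<in> \<Union>S \<Longrightarrow> pL (f v) = pS v"
    and star: "\<And>v x. \<lbrakk>x \<in> realization S; v \<in> supp x; \<And>w. w \<in> supp x \<Longrightarrow> pS v \<le> pS w\<rbrakk>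
                 \<Longrightarrow> f v \<in> supp (g x)"
begin

text \<open>Letting the weights of the vertices in stratum \<open>j\<close> tend to zero turns the star condition
  into a statement about the closed star; hence the induction over the strata of \<open>\<sigma>\<close>.\<close>

lemma image_Un_supp_in:
  assumes "z \<in> realization S" "\<And>v. v \<in> supp z \<Longrightarrow> j \<le> pS v"
    and "\<sigma> \<union> supp z \<in> S" "\<And>v. v \<in> \<sigma> \<Longrightarrow> pS v < j"
  shows "f ` \<sigma> \<union> supp (g z) \<in> L"
  using assms
proof (induction j arbitrary: \<sigma> z)
  case 0
  then have "\<sigma> = {}" by blast
  then show ?case using realizationD(2)[OF g_in[OF 0(1)]] by simp
next
  case (Suc j)
  define \<tau> where "\<tau> = {v \<in> \<sigma>. pS v = j}"
  define \<rho> where "\<rho> = {v \<in> \<sigma>. pS v < j}"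
  have \<sigma>: "\<sigma> = \<rho> \<union> \<tau>" using Suc.prems(4) by (force simp: \<rho>_def \<tau>_def)
  show ?case
  proof (cases "\<tau> = {}")
    case True
    then have "\<sigma> = \<rho>" using \<sigma> by simp
    moreover have "f ` \<rho> \<union> supp (g z) \<in> L"
    proof (rule Suc.IH[OF Suc.prems(1)])
      show "j \<le> pS v" if "v \<in> supp z" for v
        using Suc.prems(2)[OF that] by simp
      show "\<rho> \<union> supp z \<in> S" using Suc.prems(3) \<open>\<sigma> = \<rho>\<close> by simp
      show "pS v < j" if "v \<in> \<rho>" for v
        using that by (simp add: \<rho>_def)
    qed
    ultimately show ?thesis by simp
  next
    case False
    have \<tau>_un: "\<tau> \<union> supp z \<in> S"
      by (rule simplicial_complexD(3)[OF S(1) Suc.prems(3)]) (use \<sigma> False in auto)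
    have \<tau>S: "\<tau> \<in> S"
      by (rule simplicial_complexD(3)[OF S(1) \<tau>_un]) (use False in auto)
    have fin\<tau>: "finite \<tau>" using simplicial_complexD(1)[OF S(1) \<tau>S] .
    \<comment> \<open>Approach \<open>z\<close> through the join with \<open>\<tau>\<close>: for
      \<open>0 < e < 1\<close> the support of \<open>c e\<close> is
      \<open>supp z \<union> \<tau>\<close>, all of stratum at least \<open>j\<close>, so
      \<open>star\<close> applies to every vertex of \<open>\<tau>\<close>.\<close>
    define c where "c e v = (1 - e) * z v + e * barycenter \<tau> v" for e v
    have c_in: "c e \<in> realization S" if "0 \<le> e" "e \<le> 1" for e
      unfolding c_def using that \<tau>_un
      by (intro convex_comb_in_realization S Suc.prems(1) barycenter_in_realization \<tau>S)
        (simp_all add: supp_barycenter[OF fin\<tau>] Un_commute)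
    have supp_c: "supp (c e) = supp z \<union> \<tau>" if "0 < e" "e < 1" for e
    proof -
      have "c e v \<noteq> 0 \<longleftrightarrow> z v \<noteq> 0 \<or> barycenter \<tau> v \<noteq> 0" for v
        using that realizationD(1)[OF Suc.prems(1), of v]
          realizationD(1)[OF barycenter_in_realization[OF S(1) \<tau>S], of v]
        unfolding c_def by (simp add: add_nonneg_eq_0_iff)
      then show ?thesis using supp_barycenter[OF fin\<tau>] by blast
    qed
    have "continuous_on {0..1} c"
      unfolding c_def
      by (rule continuous_on_coordinatewise_then_product) (intro continuous_intros)
    then have "continuous_on {0..1} (\<lambda>e. g (c e))"
      by (rule continuous_on_compose2[OF cont_g]) (use c_in in auto)
    then have cont: "continuous_on {0..1} (\<lambda>e. g (c e) u)" for u
      by (rule continuous_on_product_then_coordinatewise)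
    have c0: "c 0 = z" by (simp add: c_def fun_eq_iff)
    have fin: "finite (supp (g z))"
      using realization_finite_supp(1)[OF L(1) g_in[OF Suc.prems(1)]] .
    \<comment> \<open>For small \<open>e\<close> no vertex of \<open>supp (g z)\<close> is lost. The
      shift by 2 keeps the parameter strictly between 0 and 1, where the support of
      \<open>c e\<close> is known.\<close>
    have "\<forall>\<^sub>F n in sequentially. g (c (1 / (real n + 2))) u \<noteq> 0" if "u \<in> supp (g z)" for u
    proof -
      have "(\<lambda>n. 1 / (real n + 2)) \<longlonglongrightarrow> 0" by real_asymp
      then have "(\<lambda>n. g (c (1 / (real n + 2))) u) \<longlonglongrightarrow> g (c 0) u"
        by (rule continuous_on_tendsto_compose[OF cont]) (auto simp: divide_simps)
      then show ?thesis
        using that c0 by (intro tendsto_imp_eventually_ne) auto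
    qed
    then have "\<forall>\<^sub>F n in sequentially. \<forall>u\<in>supp (g z). g (c (1 / (real n + 2))) u \<noteq> 0"
      by (intro eventually_ball_finite fin ballI)
    then obtain n where n: "\<forall>u\<in>supp (g z). g (c (1 / (real n + 2))) u \<noteq> 0"
      using eventually_happens'[OF sequentially_bot] by blast
    define e where "e = 1 / (real n + 2)"
    have e: "0 < e" "e < 1" by (auto simp: e_def divide_simps)
    have sub: "supp (g z) \<subseteq> supp (g (c e))" using n by (auto simp: e_def)
    have ce: "c e \<in> realization S" using c_in e by simp
    have low: "j \<le> pS v" if "v \<in> supp (c e)" for v
    proof -
      have "v \<in> supp z \<or> v \<in> \<tau>" using that supp_c[OF e] by blast
      then show ?thesis
      proof
        assume "v \<in> supp z" then show ?thesis using Suc.prems(2)[of v] by simp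
      qed (simp add: \<tau>_def)
    qed
    have "f ` \<rho> \<union> supp (g (c e)) \<in> L"
    proof (rule Suc.IH[OF ce])
      show "j \<le> pS v" if "v \<in> supp (c e)" for v
        using low[OF that] .
      have "\<rho> \<union> supp (c e) = \<sigma> \<union> supp z"
        unfolding supp_c[OF e] \<sigma> by blast
      then show "\<rho> \<union> supp (c e) \<in> S" using Suc.prems(3) by simp
      show "pS v < j" if "v \<in> \<rho>" for v
        using that by (simp add: \<rho>_def)
    qed
    moreover have "f v \<in> supp (g (c e))" if "v \<in> \<tau>" for v
    proof (rule star[OF ce])
      show "v \<in> supp (c e)" using that supp_c[OF e] by blast
      show "pS v \<le> pS w" if "w \<in> supp (c e)" for w
        using low[OF that] \<open>v \<in> \<tau>\<close> by (simp add: \<tau>_def)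
    qed
    then have "f ` \<sigma> \<union> supp (g z) \<subseteq> f ` \<rho> \<union> supp (g (c e))"
      using sub unfolding \<sigma> by blast
    moreover have "f ` \<sigma> \<union> supp (g z) \<noteq> {}" using \<sigma> False by blast
    ultimately show ?thesis using simplicial_complexD(3)[OF L(1)] by blast
  qed
qed

text \<open>At the barycenter of the face \<open>\<tau>\<close> in the top stratum,
  \<open>star\<close> puts the images of all vertices of \<open>\<tau>\<close> into the support of
  the value of \<open>g\<close>; \<open>image_Un_supp_in\<close> joins the images of the remaining
  vertices to it.\<close>

lemma image_simplex_in:
  assumes "\<rho> \<in> S"
  shows "f ` \<rho> \<in> L"
proof -
  note \<rho> = simplicial_complexD[OF S(1) assms]
  define j where "j = Max (pS ` \<rho>)"
  define \<tau> where "\<tau> = {v \<in> \<rho>. pS v = j}"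
  have j: "pS v \<le> j" if "v \<in> \<rho>" for v using \<rho>(1) that by (simp add: j_def)
  have "j \<in> pS ` \<rho>" unfolding j_def using \<rho>(1,2) by (intro Max_in) auto
  then have "\<tau> \<noteq> {}" by (auto simp: \<tau>_def)
  then have \<tau>S: "\<tau> \<in> S" by (intro \<rho>(3)) (auto simp: \<tau>_def)
  then have fin: "finite \<tau>" using simplicial_complexD(1)[OF S(1)] by blast
  have z: "barycenter \<tau> \<in> realization S" by (rule barycenter_in_realization[OF S(1) \<tau>S])
  have sz: "supp (barycenter \<tau>) = \<tau>" by (rule supp_barycenter[OF fin])
  have "f ` (\<rho> - \<tau>) \<union> supp (g (barycenter \<tau>)) \<in> L"
  proof (rule image_Un_supp_in[OF z])
    show "j \<le> pS v" if "v \<in> supp (barycenter \<tau>)" for v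
      using that unfolding sz by (simp add: \<tau>_def)
    have "\<rho> - \<tau> \<union> \<tau> = \<rho>" by (auto simp: \<tau>_def)
    then show "\<rho> - \<tau> \<union> supp (barycenter \<tau>) \<in> S" unfolding sz using assms by simp
    show "pS v < j" if "v \<in> \<rho> - \<tau>" for v
      using that j[of v] by (auto simp: \<tau>_def)
  qed
  moreover have "f v \<in> supp (g (barycenter \<tau>))" if "v \<in> \<tau>" for v
    by (rule star[OF z]) (use that in \<open>unfold sz, auto simp: \<tau>_def\<close>)
  then have "f ` \<rho> \<subseteq> f ` (\<rho> - \<tau>) \<union> supp (g (barycenter \<tau>))"
    by blast
  moreover have "f ` \<rho> \<noteq> {}" using \<rho>(2) by blast
  ultimately show ?thesis using simplicial_complexD(3)[OF L(1)] by blast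
qed

lemma simplicial_map: "simplicial_map_strat S pS L pL f"
  using image_simplex_in strat_f by (simp add: simplicial_map_strat_def)

section \<open>The homotopy and its strata\<close>

text \<open>Put \<open>s = (q + 1) * (1 - t)\<close>, which grows from 0 to \<open>q + 1\<close> as
  \<open>t\<close> falls from 1 to 0. Stratum \<open>i\<close> is moved while \<open>s\<close> runs
  from \<open>i\<close> to \<open>i + 1\<close>. These intervals share at most endpoints, so at most
  one stratum is partly moved at any time. Hence \<open>t = 1\<close> belongs to \<open>g\<close>
  and \<open>t = 0\<close> to \<open>f\<close>.\<close>

definition ramp :: "nat \<Rightarrow> real \<Rightarrow> real" where
  "ramp i t = max 0 (min 1 ((real q + 1) * (1 - t) - real i))"

definition moved :: "('a \<Rightarrow> real) \<times> real \<Rightarrow> 'b \<Rightarrow> real" where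
  "moved p = (\<lambda>u. \<Sum>v\<in>{v \<in> \<Union>S. f v = u}. ramp (pS v) (snd p) * fst p v)"

definition mass :: "('a \<Rightarrow> real) \<times> real \<Rightarrow> real" where
  "mass p = (\<Sum>v\<in>\<Union>S. (1 - ramp (pS v) (snd p)) * fst p v)"

definition rest :: "('a \<Rightarrow> real) \<times> real \<Rightarrow> 'a \<Rightarrow> real" where
  "rest p = (\<lambda>v. (1 - ramp (pS v) (snd p)) * fst p v / mass p)"

text \<open>The strata are moved from \<open>g\<close> to \<open>f\<close> one after the other, starting with the lowest one:
  a fraction \<open>ramp (pS v) t\<close> of the weight at \<open>v\<close> is sent to the vertex \<open>f v\<close>, while \<open>g\<close>, extended
  linearly to the cone over the realization, is applied to what is left. If \<open>mass p = 0\<close>, then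
  \<open>rest p\<close> is zero and \<open>g (rest p)\<close> is meaningless, but it is multiplied by \<open>0\<close>.\<close>

definition homotopy :: "('a \<Rightarrow> real) \<times> real \<Rightarrow> 'b \<Rightarrow> real" where
  "homotopy p = (\<lambda>u. moved p u + mass p * g (rest p) u)"

lemma ramp_bounds: "0 \<le> ramp i t" "ramp i t \<le> 1"
  by (auto simp: ramp_def)

lemma ramp_lt_1_next: "ramp i t < 1 \<Longrightarrow> i < k \<Longrightarrow> ramp k t = 0"
  by (auto simp: ramp_def max_def min_def split: if_splits)

lemma finite_vertices: "finite (\<Union>S)" "finite (\<Union>L)"
  using S L simplicial_complexD(1) by blast+

lemma finite_fibre: "finite {v \<in> \<Union>S. f v = u}"
  by (rule finite_subset[OF _ finite_vertices(1)]) blast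

context
  fixes x :: "'a \<Rightarrow> real" and t :: real
  assumes x: "x \<in> realization S"
begin

lemma weight_nonneg: "0 \<le> ramp (pS v) t * x v" "0 \<le> (1 - ramp (pS v) t) * x v"
  using ramp_bounds realizationD(1)[OF x] by simp_all

lemma mass_nonneg: "0 \<le> mass (x, t)"
  unfolding mass_def using weight_nonneg by (intro sum_nonneg) simp

lemma mass_eq_0_iff: "mass (x, t) = 0 \<longleftrightarrow> (\<forall>v\<in>supp x. ramp (pS v) t = 1)"
proof -
  have "mass (x, t) = 0 \<longleftrightarrow> (\<forall>v\<in>\<Union>S. (1 - ramp (pS v) t) * x v = 0)"
    unfolding mass_def fst_conv snd_conv
    using weight_nonneg(2) finite_vertices by (intro sum_nonneg_eq_0_iff) auto
  also have "\<dots> \<longleftrightarrow> (\<forall>v\<in>supp x. ramp (pS v) t = 1)"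
    using realization_finite_supp(3)[OF S(1) x] by auto
  finally show ?thesis .
qed

lemma supp_rest:
  assumes "mass (x, t) \<noteq> 0"
  shows "supp (rest (x, t)) = {v \<in> supp x. ramp (pS v) t < 1}"
proof -
  have "rest (x, t) v \<noteq> 0 \<longleftrightarrow> x v \<noteq> 0 \<and> ramp (pS v) t < 1" for v
    using assms ramp_bounds(2)[of "pS v" t] by (auto simp: rest_def)
  then show ?thesis by blast
qed

lemma rest_in:
  assumes m: "mass (x, t) \<noteq> 0"
  shows "rest (x, t) \<in> realization S"
proof -
  have sub: "supp (rest (x, t)) \<subseteq> supp x" unfolding supp_rest[OF m] by blast
  have "v \<notin> supp x \<longrightarrow> rest (x, t) v = 0" for v by (simp add: rest_def)
  moreover have "0 \<le> rest (x, t) v" for v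
    using weight_nonneg(2)[of v] mass_nonneg by (simp add: rest_def)
  moreover have "sum (rest (x, t)) (supp x) = 1"
  proof -
    have "mass (x, t) = (\<Sum>v\<in>supp x. (1 - ramp (pS v) t) * x v)"
      unfolding mass_def fst_conv snd_conv
      by (rule sum.mono_neutral_right)
        (use finite_vertices realization_finite_supp(3)[OF S(1) x] in auto)
    then show ?thesis using m by (simp add: rest_def flip: sum_divide_distrib)
  qed
  ultimately have "rest (x, t) \<in> closed_simplex (supp x)"
    unfolding closed_simplex_def by blast
  then show ?thesis
    using closed_simplex_subset_realization[OF S(1) realizationD(2)[OF x]] by blast
qed

lemma moved_nonneg: "0 \<le> moved (x, t) u"
  unfolding moved_def using weight_nonneg by (intro sum_nonneg) simp

lemma supp_moved: "supp (moved (x, t)) = f ` {v \<in> supp x. ramp (pS v) t \<noteq> 0}"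
proof -
  have "moved (x, t) u = 0 \<longleftrightarrow> (\<forall>v\<in>{v \<in> \<Union>S. f v = u}. ramp (pS v) t * x v = 0)" for u
    unfolding moved_def fst_conv snd_conv
    using weight_nonneg(1) by (intro sum_nonneg_eq_0_iff finite_fibre)
  then have "moved (x, t) u \<noteq> 0 \<longleftrightarrow> (\<exists>v\<in>\<Union>S. f v = u \<and> ramp (pS v) t \<noteq> 0 \<and> x v \<noteq> 0)" for u
    by auto
  then have "supp (moved (x, t)) = {u. \<exists>v\<in>\<Union>S. f v = u \<and> ramp (pS v) t \<noteq> 0 \<and> x v \<noteq> 0}"
    by (simp only:)
  also have "\<dots> = f ` {v \<in> \<Union>S. x v \<noteq> 0 \<and> ramp (pS v) t \<noteq> 0}"
    by auto
  also have "{v \<in> \<Union>S. x v \<noteq> 0 \<and> ramp (pS v) t \<noteq> 0} = {v \<in> supp x. ramp (pS v) t \<noteq> 0}"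
    using realization_finite_supp(3)[OF S(1) x] by auto
  finally show ?thesis .
qed

lemma sum_moved: "sum (moved (x, t)) (\<Union>L) + mass (x, t) = 1"
proof -
  have fV: "f ` \<Union>S \<subseteq> \<Union>L" using image_simplex_in by blast
  have "sum (moved (x, t)) (\<Union>L) = (\<Sum>v\<in>\<Union>S. ramp (pS v) t * x v)"
    unfolding moved_def fst_conv snd_conv using finite_vertices fV by (rule sum.group)
  then have "sum (moved (x, t)) (\<Union>L) + mass (x, t) = sum x (\<Union>S)"
    unfolding mass_def fst_conv snd_conv by (simp add: algebra_simps flip: sum.distrib)
  also have "\<dots> = 1"
    by (rule realization_sum_eq_1[OF x finite_vertices(1) realization_finite_supp(3)[OF S(1) x]])
  finally show ?thesis .
qed

text \<open>All summands are nonnegative, so nothing cancels.\<close>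

lemma supp_homotopy:
  "supp (homotopy (x, t)) = supp (moved (x, t)) \<union> (if mass (x, t) = 0 then {} else supp (g (rest (x, t))))"
proof (cases "mass (x, t) = 0")
  case True then show ?thesis by (simp add: homotopy_def)
next
  case False
  have "homotopy (x, t) u \<noteq> 0 \<longleftrightarrow> moved (x, t) u \<noteq> 0 \<or> g (rest (x, t)) u \<noteq> 0" for u
    using moved_nonneg[of u] mass_nonneg False realizationD(1)[OF g_in[OF rest_in[OF False]], of u]
    unfolding homotopy_def by (simp add: add_nonneg_eq_0_iff)
  then show ?thesis using False by auto
qed

text \<open>Let \<open>j\<close> be the lowest stratum of \<open>x\<close> that is not completely
  moved. The strata below it have arrived at \<open>f\<close>, those above are untouched, and the
  vertices \<open>f v\<close> with \<open>v\<close> in stratum \<open>j\<close> lie in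
  \<open>supp (g z)\<close> by \<open>star\<close>. So the support is the image of
  \<open>\<sigma>\<close> under \<open>f\<close> together with \<open>supp (g z)\<close>, however
  far stratum \<open>j\<close> has been moved, and \<open>image_Un_supp_in\<close> applies.\<close>

lemma homotopy_supp_strat:
  "supp (homotopy (x, t)) \<in> L \<and> strat pL (homotopy (x, t)) = strat pS x"
proof (cases "mass (x, t) = 0")
  case True
  have *: "v \<in> supp x \<Longrightarrow> ramp (pS v) t \<noteq> 0" for v
    using True mass_eq_0_iff by force
  then have "{v \<in> supp x. ramp (pS v) t \<noteq> 0} = supp x" by blast
  then have s: "supp (homotopy (x, t)) = f ` supp x"
    using True unfolding supp_homotopy supp_moved by simp
  have "pL ` f ` supp x = pS ` supp x"
    using strat_f realization_finite_supp(3)[OF S(1) x] by (force simp: image_image)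
  then show ?thesis
    unfolding strat_def s using image_simplex_in[OF realizationD(2)[OF x]] by simp
next
  case False
  define z where "z = rest (x, t)"
  have z: "z \<in> realization S" unfolding z_def by (rule rest_in[OF False])
  have sz: "supp z = {v \<in> supp x. ramp (pS v) t < 1}" unfolding z_def by (rule supp_rest[OF False])
  have fz: "finite (supp z)" "supp z \<noteq> {}" using realization_finite_supp[OF S(1) z] by simp_all
  define j where "j = Min (pS ` supp z)"
  have j: "j \<le> pS v" if "v \<in> supp z" for v using that fz by (simp add: j_def)
  have "j \<in> pS ` supp z" unfolding j_def using fz by (intro Min_in) simp_all
  then have rj: "ramp j t < 1" using sz by auto
  \<comment> \<open>\<open>ramp\<close> is below 1 from stratum \<open>j\<close> upwards, so passing
    to \<open>z\<close> discards only vertices below \<open>j\<close>.\<close>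
  have high: "v \<in> supp z" if "v \<in> supp x" "j \<le> pS v" for v
  proof (cases "pS v = j")
    case True then show ?thesis using that rj sz by auto
  next
    case False
    then show ?thesis using that ramp_lt_1_next[OF rj, of "pS v"] sz by auto
  qed
  define \<sigma> where "\<sigma> = {v \<in> supp x. pS v < j}"
  have sx: "supp x = \<sigma> \<union> supp z" using high sz by (force simp: \<sigma>_def)
  have r1: "ramp (pS v) t = 1" if "v \<in> \<sigma>" for v
  proof -
    have "v \<notin> supp z" using j[of v] that by (auto simp: \<sigma>_def)
    then show ?thesis using that sz ramp_bounds(2)[of "pS v" t] by (auto simp: \<sigma>_def)
  qed
  have f_low: "f v \<in> supp (g z)" if "v \<in> supp z" "pS v = j" for v
    by (rule star[OF z that(1)]) (use that j in auto)
  have "supp (moved (x, t)) \<subseteq> f ` \<sigma> \<union> supp (g z)"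
  proof
    fix u assume "u \<in> supp (moved (x, t))"
    then obtain v where v: "v \<in> supp x" "ramp (pS v) t \<noteq> 0" "u = f v"
      unfolding supp_moved by blast
    show "u \<in> f ` \<sigma> \<union> supp (g z)"
    proof (cases "pS v < j")
      case True then show ?thesis using v by (auto simp: \<sigma>_def)
    next
      case False
      then have "pS v = j" using ramp_lt_1_next[OF rj, of "pS v"] v(2) by force
      then show ?thesis using f_low[OF high[OF v(1)]] v(3) by simp
    qed
  qed
  moreover have "f ` \<sigma> \<subseteq> supp (moved (x, t))"
    unfolding supp_moved using r1 by (force simp: \<sigma>_def)
  ultimately have s: "supp (homotopy (x, t)) = f ` \<sigma> \<union> supp (g z)"
    unfolding supp_homotopy z_def[symmetric] using False by auto
  have fin: "finite \<sigma>" "finite (supp (g z))" "supp (g z) \<noteq> {}"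
    using realization_finite_supp[OF S(1) x] realization_finite_supp[OF L(1) g_in[OF z]]
    by (simp_all add: \<sigma>_def)
  have "f ` \<sigma> \<union> supp (g z) \<in> L"
  proof (rule image_Un_supp_in[OF z j])
    show "\<sigma> \<union> supp z \<in> S" unfolding sx[symmetric] by (rule realizationD(2)[OF x])
    show "pS v < j" if "v \<in> \<sigma>" for v using that by (simp add: \<sigma>_def)
  qed
  moreover have "strat pL (homotopy (x, t)) = strat pS x"
  proof -
    have m: "Max (pL ` supp (g z)) = Max (pS ` supp z)"
      using strat_g[OF z] by (simp add: strat_def)
    have "pL (f v) = pS v" if "v \<in> \<sigma>" for v
      using that strat_f realization_finite_supp(3)[OF S(1) x] unfolding \<sigma>_def by blast
    then have "pL ` f ` \<sigma> = pS ` \<sigma>"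
      unfolding image_image by (rule image_cong[OF refl])
    then have "strat pL (homotopy (x, t)) = Max (pS ` \<sigma> \<union> pL ` supp (g z))"
      unfolding strat_def s by (simp add: image_Un)
    also have "\<dots> = Max (pS ` \<sigma> \<union> pS ` supp z)"
    proof (cases "\<sigma> = {}")
      case True then show ?thesis using m by (simp only: image_empty Un_empty_left)
    next
      case False
      then have "Max (pS ` \<sigma> \<union> pL ` supp (g z)) = max (Max (pS ` \<sigma>)) (Max (pS ` supp z))"
        using fin unfolding m[symmetric] by (intro Max_Un) simp_all
      also have "\<dots> = Max (pS ` \<sigma> \<union> pS ` supp z)"
        using False fin fz by (intro Max_Un[symmetric]) simp_all
      finally show ?thesis .
    qed
    finally show ?thesis unfolding strat_def sx image_Un .
  qed
  ultimately show ?thesis unfolding s ..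
qed

lemma homotopy_in: "homotopy (x, t) \<in> realization L"
proof (rule realizationI)
  show sL: "supp (homotopy (x, t)) \<in> L" using homotopy_supp_strat by blast
  show "0 \<le> homotopy (x, t) u" for u
  proof (cases "mass (x, t) = 0")
    case True then show ?thesis using moved_nonneg by (simp add: homotopy_def)
  next
    case False
    then show ?thesis
      using moved_nonneg mass_nonneg realizationD(1)[OF g_in[OF rest_in[OF False]]]
      by (simp add: homotopy_def)
  qed
  \<comment> \<open>The case of mass 0 is separate because \<open>rest (x, t)\<close> is then no
    point of the realization and the sum over its image is unknown.\<close>
  have "mass (x, t) * sum (g (rest (x, t))) (\<Union>L) = mass (x, t)"
  proof (cases "mass (x, t) = 0")
    case False
    note r = g_in[OF rest_in[OF False]]
    show ?thesis
      using realization_sum_eq_1[OF r finite_vertices(2) realization_finite_supp(3)[OF L(1) r]] by simp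
  qed simp
  then have "sum (homotopy (x, t)) (\<Union>L) = 1"
    unfolding homotopy_def sum.distrib sum_distrib_left[symmetric] using sum_moved by (simp only:)
  moreover have "supp (homotopy (x, t)) \<subseteq> \<Union>L" using sL by blast
  ultimately show "sum (homotopy (x, t)) (supp (homotopy (x, t))) = 1"
    using sum_supp[OF finite_vertices(2)] by metis
qed

lemma homotopy_0: "homotopy (x, 0) = real_map f x"
proof -
  have r: "ramp (pS v) 0 = 1" if "v \<in> \<Union>S" for v
    using pS_le[OF that] by (simp add: ramp_def)
  then have "mass (x, 0) = 0" by (simp add: mass_def)
  moreover have "moved (x, 0) u = real_map f x u" for u
  proof -
    have "moved (x, 0) u = (\<Sum>v\<in>{v \<in> \<Union>S. f v = u}. x v)"
      unfolding moved_def fst_conv snd_conv by (rule sum.cong) (use r in auto)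
    also have "\<dots> = real_map f x u"
      unfolding real_map_def
      by (rule sum.mono_neutral_right[OF finite_fibre])
        (use realization_finite_supp(3)[OF S(1) x] in auto)
    finally show ?thesis .
  qed
  ultimately show ?thesis by (simp add: homotopy_def fun_eq_iff)
qed

lemma homotopy_1: "homotopy (x, 1) = g x"
proof -
  have r: "ramp i 1 = 0" for i by (simp add: ramp_def)
  have "mass (x, 1) = 1"
    using realization_sum_eq_1[OF x finite_vertices(1) realization_finite_supp(3)[OF S(1) x]]
    by (simp add: mass_def r)
  then show ?thesis by (simp add: homotopy_def moved_def rest_def r)
qed

end

lemma continuous_on_ramp [continuous_intros]:
  "continuous_on A h \<Longrightarrow> continuous_on A (\<lambda>p. ramp i (h p))"
  unfolding ramp_def by (intro continuous_intros)

lemma continuous_on_fst_apply: "continuous_on A (\<lambda>p :: ('a \<Rightarrow> real) \<times> real. fst p v)"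
  by (rule continuous_on_product_then_coordinatewise) (intro continuous_intros)

text \<open>Continuity in each coordinate is enough: \<open>L\<close> is finite, so
  \<open>strat_homotopic\<close> can convert it into continuity for the weak topology.\<close>

lemma continuous_on_homotopy: "continuous_on (realization S \<times> {0..1}) homotopy"
proof (rule continuous_on_coordinatewise_then_product)
  fix u
  let ?D = "realization S \<times> {0..1::real}"
  have m: "continuous_on A mass" for A
    unfolding mass_def by (intro continuous_intros continuous_on_fst_apply)
  have "continuous_on {p \<in> ?D. mass p \<noteq> 0} rest"
    unfolding rest_def
    by (intro continuous_on_coordinatewise_then_product continuous_on_divide continuous_on_mult
        continuous_on_diff continuous_on_const continuous_on_ramp continuous_on_snd continuous_on_id
        continuous_on_fst_apply m) auto
  then have "continuous_on {p \<in> ?D. mass p \<noteq> 0} (\<lambda>p. g (rest p))"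
    by (rule continuous_on_compose2[OF cont_g]) (use rest_in in auto)
  then have "continuous_on {p \<in> ?D. mass p \<noteq> 0} (\<lambda>p. g (rest p) u)"
    by (rule continuous_on_product_then_coordinatewise)
  moreover have "\<bar>g (rest p) u\<bar> \<le> 1" if "p \<in> ?D" "mass p \<noteq> 0" for p
  proof -
    have r: "g (rest p) \<in> realization L"
      using that by (cases p) (auto intro: g_in rest_in)
    show ?thesis using realization_le_1[OF L(1) r, of u] realizationD(1)[OF r, of u] by simp
  qed
  ultimately have "continuous_on ?D (\<lambda>p. mass p * g (rest p) u)"
    by (intro continuous_on_mult_vanishing m)
  then show "continuous_on ?D (\<lambda>p. homotopy p u)"
    unfolding homotopy_def moved_def
    by (intro continuous_on_add continuous_on_sum continuous_on_mult[OF _ continuous_on_fst_apply]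
        continuous_on_ramp continuous_on_snd continuous_on_id)
qed

lemma strat_homotopic: "strat_homotopic S pS L pL (real_map f) g"
  unfolding strat_homotopic_def
proof (intro exI[of _ homotopy] conjI ballI)
  have "homotopy ` (realization S \<times> {0..1}) \<subseteq> realization L"
    using homotopy_in by auto
  then show "continuous_map (prod_topology (realization_top S) (top_of_set {0..1})) (realization_top L) homotopy"
    using continuous_map_realizationI[OF L continuous_on_homotopy]
    by (simp add: realization_top_finite[OF S])
qed (simp_all add: homotopy_supp_strat homotopy_0 homotopy_1)

end

section \<open>Relative barycentric subdivision\<close>

lemma subdiv_homeo_eq_sum:
  assumes "finite \<sigma>" "supp t \<subseteq> \<sigma>"
  shows "subdiv_homeo pos t u = (\<Sum>w\<in>\<sigma>. t w * pos w u)"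
  unfolding subdiv_homeo_def by (rule sum.mono_neutral_left) (use assms in auto)

context
  fixes S :: "'v sdv set set" and t :: "'v sdv \<Rightarrow> real" and pos :: "'v sdv \<Rightarrow> 'v \<Rightarrow> real"
  assumes S: "simplicial_complex S" and t: "t \<in> realization S"
begin

lemma subdiv_homeo_close:
  assumes "\<And>w. w \<in> supp t \<Longrightarrow> \<bar>pos w u - c\<bar> \<le> D"
  shows "\<bar>subdiv_homeo pos t u - c\<bar> \<le> D"
proof -
  have "subdiv_homeo pos t u - c = (\<Sum>w\<in>supp t. t w * (pos w u - c))"
    using realizationD(3)[OF t]
    by (simp add: subdiv_homeo_def right_diff_distrib sum_subtractf flip: sum_distrib_right)
  also have "\<bar>\<dots>\<bar> \<le> (\<Sum>w\<in>supp t. \<bar>t w * (pos w u - c)\<bar>)"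
    by (rule sum_abs)
  also have "\<dots> \<le> (\<Sum>w\<in>supp t. t w * D)"
    using assms realizationD(1)[OF t] by (intro sum_mono) (simp add: abs_mult mult_left_mono)
  also have "\<dots> = D"
    using realizationD(3)[OF t] by (simp flip: sum_distrib_right)
  finally show ?thesis .
qed

lemma sum_subdiv_homeo:
  "(\<Sum>u\<in>B. subdiv_homeo pos t u) = (\<Sum>w\<in>supp t. t w * (\<Sum>u\<in>B. pos w u))"
  unfolding subdiv_homeo_def by (subst sum.swap) (simp add: sum_distrib_left)

text \<open>A lower bound for a partial mass is a convex condition. With \<open>B\<close> the
  vertices of \<open>K\<close> in stratum \<open>j\<close>, this keeps new vertices of that stratum
  away from the lower strata.\<close>

lemma sum_subdiv_homeo_ge:
  assumes "\<And>w. w \<in> supp t \<Longrightarrow> \<epsilon> \<le> (\<Sum>u\<in>B. pos w u)"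
  shows "\<epsilon> \<le> (\<Sum>u\<in>B. subdiv_homeo pos t u)"
proof -
  have "\<epsilon> = (\<Sum>w\<in>supp t. t w * \<epsilon>)"
    using realizationD(3)[OF t] by (simp flip: sum_distrib_right)
  also have "\<dots> \<le> (\<Sum>w\<in>supp t. t w * (\<Sum>u\<in>B. pos w u))"
    using assms realizationD(1)[OF t] by (intro sum_mono mult_left_mono) auto
  finally show ?thesis unfolding sum_subdiv_homeo .
qed

lemma subdiv_homeo_in_closed_simplex:
  assumes "\<And>w. w \<in> supp t \<Longrightarrow> pos w \<in> closed_simplex \<rho>"
  shows "subdiv_homeo pos t \<in> closed_simplex \<rho>"
proof -
  have 1: "0 \<le> pos w v" "v \<notin> \<rho> \<longrightarrow> pos w v = 0" "sum (pos w) \<rho> = 1" if "w \<in> supp t" for w v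
    using assms[OF that] unfolding closed_simplex_def by blast+
  have "0 \<le> subdiv_homeo pos t v" for v
    unfolding subdiv_homeo_def using 1(1) realizationD(1)[OF t] by (intro sum_nonneg mult_nonneg_nonneg) auto
  moreover have "v \<notin> \<rho> \<longrightarrow> subdiv_homeo pos t v = 0" for v
    unfolding subdiv_homeo_def using 1(2) by (intro impI sum.neutral) auto
  moreover have "sum (subdiv_homeo pos t) \<rho> = 1"
    unfolding sum_subdiv_homeo using 1(3) realizationD(3)[OF t] by simp
  ultimately show ?thesis unfolding closed_simplex_def by blast
qed

text \<open>Weights and positions are nonnegative, so the support of the image point is the union of
  the supports of the vertex positions, and its top stratum is the largest stratum of these
  vertices.\<close>

lemma strat_subdiv_homeo:
  assumes nonneg: "\<And>w u. w \<in> supp t \<Longrightarrow> 0 \<le> pos w u"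
    and fin: "\<And>w. w \<in> supp t \<Longrightarrow> finite (supp (pos w)) \<and> supp (pos w) \<noteq> {}"
    and p: "\<And>w. w \<in> supp t \<Longrightarrow> strat pK (pos w) = p w"
  shows "strat pK (subdiv_homeo pos t) = strat p t"
proof -
  have ft: "finite (supp t)" "supp t \<noteq> {}"
    using realization_finite_supp[OF S t] by simp_all
  have "subdiv_homeo pos t u = 0 \<longleftrightarrow> (\<forall>w\<in>supp t. t w * pos w u = 0)" for u
    unfolding subdiv_homeo_def using ft nonneg realizationD(1)[OF t]
    by (intro sum_nonneg_eq_0_iff) (auto intro: mult_nonneg_nonneg)
  then have "subdiv_homeo pos t u \<noteq> 0 \<longleftrightarrow> (\<exists>w\<in>supp t. pos w u \<noteq> 0)" for u
    by auto
  then have "supp (subdiv_homeo pos t) = (\<Union>w\<in>supp t. supp (pos w))"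
    by auto
  then have "strat pK (subdiv_homeo pos t) = Max (\<Union>w\<in>supp t. pK ` supp (pos w))"
    unfolding strat_def by (simp only: image_UN)
  also have "\<dots> = Max (p ` supp t)"
  proof (rule Max_eq_if)
    show "finite (\<Union>w\<in>supp t. pK ` supp (pos w))" using ft fin by blast
    show "finite (p ` supp t)" using ft by blast
    show "\<forall>k\<in>\<Union>w\<in>supp t. pK ` supp (pos w). \<exists>l\<in>p ` supp t. k \<le> l"
    proof
      fix k assume "k \<in> (\<Union>w\<in>supp t. pK ` supp (pos w))"
      then obtain w where w: "w \<in> supp t" "k \<in> pK ` supp (pos w)" by blast
      then have "k \<le> p w"
        using fin[OF w(1)] unfolding p[OF w(1), symmetric] strat_def by (intro Max_ge) auto
      then show "\<exists>l\<in>p ` supp t. k \<le> l" using w(1) by blast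
    qed
    show "\<forall>l\<in>p ` supp t. \<exists>k\<in>\<Union>w\<in>supp t. pK ` supp (pos w). l \<le> k"
    proof
      fix l assume "l \<in> p ` supp t"
      then obtain w where w: "w \<in> supp t" "l = p w" by blast
      have "l \<in> pK ` supp (pos w)"
        using fin[OF w(1)] unfolding w(2) p[OF w(1), symmetric] strat_def by (intro Max_in) auto
      then show "\<exists>k\<in>\<Union>w\<in>supp t. pK ` supp (pos w). l \<le> k" using w(1) by blast
    qed
  qed
  finally show ?thesis unfolding strat_def .
qed

end

lemma subdiv_homeo_barycenter:
  assumes "finite \<sigma>"
  shows "subdiv_homeo pos (barycenter \<sigma>) u = (\<Sum>w\<in>\<sigma>. pos w u) / real (card \<sigma>)"
  unfolding subdiv_homeo_def supp_barycenter[OF assms]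
  by (simp add: barycenter_def sum_divide_distrib)

text \<open>The factor \<open>1 - 1/N\<close> arises because the average over \<open>\<tau>\<close> of the distances to a
  fixed point of \<open>\<tau>\<close> contains a zero term.\<close>

lemma barycenters_close:
  fixes pos :: "'v sdv \<Rightarrow> 'v \<Rightarrow> real"
  assumes S: "simplicial_complex S" and \<tau>: "\<tau> \<in> S" "\<rho> \<in> S" "\<rho> \<subseteq> \<tau>" and N: "card \<tau> \<le> N"
    and D: "\<And>x y. x \<in> \<tau> \<Longrightarrow> y \<in> \<tau> \<Longrightarrow> \<bar>pos x u - pos y u\<bar> \<le> D"
  shows "\<bar>subdiv_homeo pos (barycenter \<rho>) u - subdiv_homeo pos (barycenter \<tau>) u\<bar> \<le> (1 - 1 / real N) * D"
proof -
  note fin = simplicial_complexD(1,2)[OF S \<tau>(1)]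
  have fin\<rho>: "finite \<rho>" using simplicial_complexD(1)[OF S \<tau>(2)] .
  define n where "n = real (card \<tau>)"
  have n: "1 \<le> n" "n \<le> real N"
    using fin N by (simp_all add: n_def Suc_leI card_gt_0_iff)
  have D0: "0 \<le> D" using D fin(2) by force
  have "\<bar>pos a u - subdiv_homeo pos (barycenter \<tau>) u\<bar> \<le> (1 - 1 / real N) * D" if a: "a \<in> \<tau>" for a
  proof -
    have "pos a u - subdiv_homeo pos (barycenter \<tau>) u = (\<Sum>b\<in>\<tau>. pos a u - pos b u) / n"
      using n(1) unfolding subdiv_homeo_barycenter[OF fin(1)] n_def
      by (simp add: sum_subtractf field_simps)
    also have "\<dots> = (\<Sum>b\<in>\<tau> - {a}. pos a u - pos b u) / n"
      using fin(1) a by (simp add: sum.remove)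
    also have "\<bar>\<dots>\<bar> = \<bar>\<Sum>b\<in>\<tau> - {a}. pos a u - pos b u\<bar> / n"
      using n(1) by (simp add: abs_divide)
    also have "\<dots> \<le> (\<Sum>b\<in>\<tau> - {a}. D) / n"
    proof (rule divide_right_mono)
      have "\<bar>\<Sum>b\<in>\<tau> - {a}. pos a u - pos b u\<bar> \<le> (\<Sum>b\<in>\<tau> - {a}. \<bar>pos a u - pos b u\<bar>)"
        by (rule sum_abs)
      also have "\<dots> \<le> (\<Sum>b\<in>\<tau> - {a}. D)"
        by (rule sum_mono) (use D a in blast)
      finally show "\<bar>\<Sum>b\<in>\<tau> - {a}. pos a u - pos b u\<bar> \<le> (\<Sum>b\<in>\<tau> - {a}. D)" .
    qed (use n(1) in simp)
    also have "\<dots> = (1 - 1 / n) * D"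
    proof -
      have "real (card (\<tau> - {a})) = n - 1"
        using n(1) fin(1) a by (simp add: n_def of_nat_diff)
      then have "(\<Sum>b\<in>\<tau> - {a}. D) = (n - 1) * D"
        by (simp only: sum_constant)
      then show ?thesis using n(1) by (simp only:) (simp add: field_simps)
    qed
    also have "\<dots> \<le> (1 - 1 / real N) * D"
      using n D0 by (intro mult_right_mono) (simp_all add: frac_le)
    finally show ?thesis .
  qed
  \<comment> \<open>The bound for single vertices of \<open>\<tau>\<close> passes to the barycenter
    of the face \<open>\<rho>\<close> by convexity.\<close>
  then show ?thesis
    using \<tau>(3) by (intro subdiv_homeo_close[OF S barycenter_in_realization[OF S \<tau>(2)]])
      (auto simp: supp_barycenter[OF fin\<rho>])
qed

text \<open>A basic open set of the product topology restricts finitely many coordinates, so the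
  least of finitely many radii works. This gives neighbourhoods in the form of the coordinatewise
  mesh bounds.\<close>

lemma box_neighbourhood:
  fixes c :: "'a \<Rightarrow> real"
  assumes "open W" "c \<in> W"
  obtains \<delta> where "0 < \<delta>" "\<And>y. (\<And>u. \<bar>y u - c u\<bar> < \<delta>) \<Longrightarrow> y \<in> W"
proof -
  have "openin (product_topology (\<lambda>i::'a. euclidean :: real topology) UNIV) W"
    using assms(1) by (simp add: open_fun_def)
  from product_topology_open_contains_basis[OF this assms(2)]
  obtain X where X: "c \<in> (\<Pi>\<^sub>E i\<in>UNIV. X i)" "\<And>i. open (X i)" "finite {i. X i \<noteq> UNIV}"
      "(\<Pi>\<^sub>E i\<in>UNIV. X i) \<subseteq> W"
    by auto
  have "\<exists>d>0. ball (c i) d \<subseteq> X i" for i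
    using X(1,2) by (auto simp: PiE_def intro: openE)
  then obtain d where d: "\<And>i. 0 < d i" "\<And>i. ball (c i) (d i) \<subseteq> X i"
    by metis
  define \<delta> where "\<delta> = Min (insert 1 (d ` {i. X i \<noteq> UNIV}))"
  have "0 < \<delta>" unfolding \<delta>_def using X(3) d(1) by (subst Min_gr_iff) auto
  moreover have "y \<in> W" if y: "\<And>u. \<bar>y u - c u\<bar> < \<delta>" for y
  proof -
    have "y i \<in> X i" for i
    proof (cases "X i = UNIV")
      case False
      then have "\<delta> \<le> d i" unfolding \<delta>_def using X(3) by (intro Min_le) auto
      then have "y i \<in> ball (c i) (d i)" using y[of i] by (simp add: dist_real_def abs_minus_commute)
      then show ?thesis using d(2) by blast
    qed simp
    then show ?thesis using X(4) by (auto simp: PiE_def)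
  qed
  ultimately show ?thesis by (rule that)
qed

section \<open>Combinatorics of the relative subdivision\<close>

primrec vertex_stratum :: "('v \<Rightarrow> nat) \<Rightarrow> 'v sdv \<Rightarrow> nat" where
  "vertex_stratum p (Orig v) = p v"
| "vertex_stratum p (Bary \<tau>) = Max (fset (fimage (vertex_stratum p) \<tau>))"

abbreviation bary :: "'v sdv set \<Rightarrow> 'v sdv" where
  "bary \<tau> \<equiv> Bary (Abs_fset \<tau>)"

lemma fset_Abs_fset: "finite A \<Longrightarrow> fset (Abs_fset A) = A"
  by (simp add: Abs_fset_inverse)

text \<open>\<open>\<rho>\<close> is the simplex \<open>X \<union> \<Union>T\<close> of
  \<open>S\<close> in which all pieces of \<open>\<sigma>\<close> live; estimates on
  \<open>\<sigma>\<close> are reduced to estimates on \<open>\<rho>\<close>.\<close>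

lemma sd_relE:
  assumes "\<sigma> \<in> sd_rel S A"
  obtains \<rho> T where "\<rho> \<in> S" "finite T" "\<And>\<tau>. \<tau> \<in> T \<Longrightarrow> \<tau> \<in> S \<and> \<tau> \<subseteq> \<rho> \<and> \<tau> \<inter> A = {}"
    "\<And>\<tau> \<tau>'. \<tau> \<in> T \<Longrightarrow> \<tau>' \<in> T \<Longrightarrow> \<tau> \<subseteq> \<tau>' \<or> \<tau>' \<subseteq> \<tau>" "\<sigma> \<subseteq> \<rho> \<inter> A \<union> bary ` T"
proof -
  from assms obtain X T where XT: "\<sigma> = X \<union> bary ` T" "X \<subseteq> A" "finite T"
    "\<forall>\<tau>\<in>T. \<tau> \<in> S \<and> \<tau> \<inter> A = {}" "\<forall>\<tau>1\<in>T. \<forall>\<tau>2\<in>T. \<tau>1 \<subseteq> \<tau>2 \<or> \<tau>2 \<subseteq> \<tau>1" "X \<union> \<Union>T \<in> S"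
    unfolding sd_rel_def mem_Collect_eq by (elim exE conjE) (rule that; assumption)
  show ?thesis
  proof (rule that[OF XT(6,3)])
    show "\<tau> \<in> S \<and> \<tau> \<subseteq> X \<union> \<Union>T \<and> \<tau> \<inter> A = {}" if "\<tau> \<in> T" for \<tau>
      using XT(4) that by auto
    show "\<tau> \<subseteq> \<tau>' \<or> \<tau>' \<subseteq> \<tau>" if "\<tau> \<in> T" "\<tau>' \<in> T" for \<tau> \<tau>'
      using XT(5) that by simp
    show "\<sigma> \<subseteq> (X \<union> \<Union>T) \<inter> A \<union> bary ` T"
      using XT(1,2) by auto
  qed
qed

lemma simplicial_complex_sd_rel:
  assumes S: "simplicial_complex S"
  shows "simplicial_complex (sd_rel S A)"
  unfolding simplicial_complex_def
proof (intro conjI ballI allI impI)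
  fix \<sigma> assume "\<sigma> \<in> sd_rel S A"
  then obtain X T where \<sigma>: "\<sigma> = X \<union> bary ` T" "X \<subseteq> A" "finite T"
    "\<forall>\<tau>\<in>T. \<tau> \<in> S \<and> \<tau> \<inter> A = {}" "\<forall>\<tau>1\<in>T. \<forall>\<tau>2\<in>T. \<tau>1 \<subseteq> \<tau>2 \<or> \<tau>2 \<subseteq> \<tau>1" "X \<union> \<Union>T \<in> S"
    unfolding sd_rel_def mem_Collect_eq by (elim exE conjE) (rule that; assumption)
  note XT = simplicial_complexD[OF S \<sigma>(6)]
  show "finite \<sigma>" using \<sigma>(1,3) XT(1) by simp
  show "\<sigma> \<noteq> {}" using \<sigma>(1) XT(2) by auto
  fix \<sigma>' assume sub: "\<sigma>' \<subseteq> \<sigma> \<and> \<sigma>' \<noteq> {}"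
  define T' where "T' = {\<tau> \<in> T. bary \<tau> \<in> \<sigma>'}"
  have T': "T' \<subseteq> T" by (auto simp: T'_def)
  have eq: "\<sigma>' = (\<sigma>' \<inter> X) \<union> bary ` T'" using sub \<sigma>(1) by (auto simp: T'_def)
  have "(\<sigma>' \<inter> X) \<union> \<Union>T' \<noteq> {}"
  proof
    assume e: "(\<sigma>' \<inter> X) \<union> \<Union>T' = {}"
    have "T' = {}" using e T' \<sigma>(4) simplicial_complexD(2)[OF S] by blast
    then show False using e eq sub by simp
  qed
  then have "(\<sigma>' \<inter> X) \<union> \<Union>T' \<in> S" using T' by (intro XT(3)) auto
  moreover have "\<sigma>' \<inter> X \<subseteq> A" "finite T'" using \<sigma>(2,3) T' finite_subset by auto
  moreover have "\<forall>\<tau>\<in>T'. \<tau> \<in> S \<and> \<tau> \<inter> A = {}" using \<sigma>(4) T' by blast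
  moreover have "\<forall>\<tau>1\<in>T'. \<forall>\<tau>2\<in>T'. \<tau>1 \<subseteq> \<tau>2 \<or> \<tau>2 \<subseteq> \<tau>1" using \<sigma>(5) T' by blast
  ultimately show "\<sigma>' \<in> sd_rel S A"
    unfolding sd_rel_def using eq by blast
qed

lemma finite_sd_rel:
  assumes "finite S" "finite (\<Union>S)"
  shows "finite (sd_rel S A)"
proof (rule finite_subset)
  show "sd_rel S A \<subseteq> Pow (\<Union>S \<union> bary ` S)"
  proof
    fix \<sigma> assume "\<sigma> \<in> sd_rel S A"
    then obtain \<rho> T where "\<rho> \<in> S" "\<And>\<tau>. \<tau> \<in> T \<Longrightarrow> \<tau> \<in> S \<and> \<tau> \<subseteq> \<rho> \<and> \<tau> \<inter> A = {}"
      "\<sigma> \<subseteq> \<rho> \<inter> A \<union> bary ` T"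
      using sd_relE by metis
    then show "\<sigma> \<in> Pow (\<Union>S \<union> bary ` S)" by blast
  qed
  show "finite (Pow (\<Union>S \<union> bary ` S))" using assms by simp
qed

text \<open>The members of a chain of nonempty subsets of \<open>\<rho> - A\<close> have different
  cardinalities between 1 and \<open>card (\<rho> - A)\<close>. Thus \<open>N\<close> stays the same
  in all rounds, and so does the contraction factor \<open>1 - 1/N\<close>.\<close>

lemma card_sd_rel_le:
  assumes S: "simplicial_complex S" and "\<sigma> \<in> sd_rel S A" "\<sigma> \<inter> A = {}"
    and N: "\<And>\<tau>. \<tau> \<in> S \<Longrightarrow> \<tau> \<inter> A = {} \<Longrightarrow> card \<tau> \<le> N"
  shows "card \<sigma> \<le> N"
proof -
  obtain \<rho> T where \<rho>: "\<rho> \<in> S" "finite T" and T: "\<And>\<tau>. \<tau> \<in> T \<Longrightarrow> \<tau> \<in> S \<and> \<tau> \<subseteq> \<rho> \<and> \<tau> \<inter> A = {}"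
    and chain: "\<And>\<tau> \<tau>'. \<tau> \<in> T \<Longrightarrow> \<tau>' \<in> T \<Longrightarrow> \<tau> \<subseteq> \<tau>' \<or> \<tau>' \<subseteq> \<tau>" and \<sigma>: "\<sigma> \<subseteq> \<rho> \<inter> A \<union> bary ` T"
    using sd_relE[OF assms(2)] by metis
  have "\<sigma> \<subseteq> bary ` T" using \<sigma> assms(3) by blast
  then have 1: "card \<sigma> \<le> card T" using surj_card_le[OF \<rho>(2)] by blast
  have fin: "finite (\<rho> - A)" using simplicial_complexD(1)[OF S \<rho>(1)] by simp
  have T1: "\<tau> \<subseteq> \<rho> - A" "\<tau> \<noteq> {}" "finite \<tau>" if "\<tau> \<in> T" for \<tau>
    using T[OF that] simplicial_complexD(1,2)[OF S, of \<tau>] by blast+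
  have "inj_on card T"
  proof (rule inj_onI)
    fix \<tau> \<tau>' assume "\<tau> \<in> T" "\<tau>' \<in> T" "card \<tau> = card \<tau>'"
    then show "\<tau> = \<tau>'" using chain[of \<tau> \<tau>'] T1(3) card_subset_eq by metis
  qed
  moreover have "card ` T \<subseteq> {1..card (\<rho> - A)}"
  proof
    fix n assume "n \<in> card ` T"
    then obtain \<tau> where "\<tau> \<in> T" "n = card \<tau>" by blast
    then show "n \<in> {1..card (\<rho> - A)}"
      using T1[of \<tau>] card_mono[OF fin, of \<tau>] by (simp add: Suc_leI card_gt_0_iff)
  qed
  ultimately have 2: "card T \<le> card (\<rho> - A)"
    using card_inj_on_le[of card T "{1..card (\<rho> - A)}"] by simp
  have "card (\<rho> - A) \<le> N"
  proof (cases "\<rho> - A = {}")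
    case False
    then have "\<rho> - A \<in> S" by (intro simplicial_complexD(3)[OF S \<rho>(1)]) auto
    then show ?thesis by (rule N) blast
  next
    case True
    then show ?thesis by (simp only: card.empty)
  qed
  then show ?thesis using 1 2 by linarith
qed

section \<open>Subdividing stratum by stratum\<close>

locale subdivision =
  fixes q :: nat and K :: "'v set set" and pK :: "'v \<Rightarrow> nat"
    and L :: "'u set set" and pL :: "'u \<Rightarrow> nat"
    and \<phi> :: "('v \<Rightarrow> real) \<Rightarrow> 'u \<Rightarrow> real"
  assumes K: "simplicial_complex K" "finite K"
    and L: "simplicial_complex L"
    and pK_le: "\<And>v. v \<in> \<Union>K \<Longrightarrow> pK v \<le> q"
    and cont_phi: "continuous_on (realization K) \<phi>"
    and phi_in: "\<And>x. x \<in> realization K \<Longrightarrow> \<phi> x \<in> realization L"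
    and strat_phi: "\<And>x. x \<in> realization K \<Longrightarrow> strat pL (\<phi> x) = strat pK x"
begin

text \<open>The last clause of \<open>subdivides\<close> expresses the filtration in terms of the names of the vertices only. It
  guarantees that no newly created vertex clashes with one of the vertices that are kept.\<close>

definition subdivides :: "'v sdv set set \<Rightarrow> ('v sdv \<Rightarrow> nat) \<Rightarrow> ('v sdv \<Rightarrow> 'v \<Rightarrow> real) \<Rightarrow> bool" where
  "subdivides S p pos \<longleftrightarrow> simplicial_complex S \<and> finite S \<and>
     (\<forall>\<tau>\<in>S. \<exists>\<rho>\<in>K. \<forall>x\<in>\<tau>. pos x \<in> closed_simplex \<rho>) \<and>
     (\<forall>x\<in>\<Union>S. strat pK (pos x) = p x) \<and>
     (\<forall>x\<in>\<Union>S. p x = vertex_stratum pK x)"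

text \<open>\<open>\<phi>\<close> sends the part of the realization within distance \<open>D\<close>
  of \<open>c\<close> in every coordinate into the open star of \<open>w\<close>. Hence
  \<open>w\<close> is an admissible value of \<open>f\<close> at a vertex placed at
  \<open>c\<close>.\<close>

definition good_position :: "nat \<Rightarrow> real \<Rightarrow> ('v \<Rightarrow> real) \<Rightarrow> 'u \<Rightarrow> bool" where
  "good_position i D c w \<longleftrightarrow> pL w = i \<and>
     (\<forall>y\<in>realization K. (\<forall>u. \<bar>y u - c u\<bar> \<le> D) \<longrightarrow> \<phi> y w \<noteq> 0)"

text \<open>Later stages neither move the vertices of stratum \<open>i\<close> nor increase their distance to the
  neighbours, since these are replaced by averages; hence this property is preserved.\<close>

definition good :: "nat \<Rightarrow> 'v sdv set set \<Rightarrow> ('v sdv \<Rightarrow> nat) \<Rightarrow> ('v sdv \<Rightarrow> 'v \<Rightarrow> real) \<Rightarrow> bool" where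
  "good i S p pos \<longleftrightarrow> (\<exists>D. (\<forall>x\<in>\<Union>S. p x = i \<longrightarrow> (\<exists>w. good_position i D (pos x) w)) \<and>
     (\<forall>\<tau>\<in>S. \<forall>x\<in>\<tau>. \<forall>y\<in>\<tau>. p x = i \<longrightarrow> i \<le> p y \<longrightarrow> (\<forall>u. \<bar>pos x u - pos y u\<bar> \<le> D)))"

text \<open>On points of the realization of \<open>K\<close> without weight above stratum
  \<open>j\<close>, this measures the distance from the lower strata: it vanishes exactly if the
  point lies in a stratum below \<open>j\<close>.\<close>

abbreviation mass_in :: "nat \<Rightarrow> ('v \<Rightarrow> real) \<Rightarrow> real" where
  "mass_in j c \<equiv> \<Sum>u\<in>{u \<in> \<Union>K. pK u = j}. c u"

text \<open>Invariant of the iteration within stage \<open>j\<close>. The parameters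
  \<open>N\<close>, \<open>\<epsilon>\<close> and \<open>A\<close> stay fixed while the complex
  changes; only the mesh \<open>D\<close>, measured off \<open>A\<close>, shrinks.\<close>

definition stage :: "nat \<Rightarrow> real \<Rightarrow> nat \<Rightarrow> 'v sdv set \<Rightarrow> real \<Rightarrow> 'v fcx \<Rightarrow> bool" where
  "stage N \<epsilon> j A D X = (case X of (S, p, pos) \<Rightarrow>
     subdivides S p pos \<and> A = {w \<in> \<Union>S. p w < j} \<and> (\<forall>i<j. good i S p pos) \<and>
     (\<forall>\<tau>\<in>S. \<tau> \<inter> A = {} \<longrightarrow> card \<tau> \<le> N) \<and>
     (\<forall>x\<in>\<Union>S. p x = j \<longrightarrow> \<epsilon> \<le> mass_in j (pos x)) \<and>
     (\<forall>\<tau>\<in>S. \<forall>x\<in>\<tau>. \<forall>y\<in>\<tau>. x \<notin> A \<longrightarrow> y \<notin> A \<longrightarrow> (\<forall>u. \<bar>pos x u - pos y u\<bar> \<le> D)))"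

lemma finite_K: "finite (\<Union>K)"
  using K simplicial_complexD(1) by blast

section \<open>From good positions to a simplicial approximation\<close>

context
  fixes S p pos
  assumes sub: "subdivides S p pos"
begin

lemma simplicial: "simplicial_complex S" "finite S"
  using sub unfolding subdivides_def by blast+

lemma finite_simplex: "\<tau> \<in> S \<Longrightarrow> finite \<tau>" "\<tau> \<in> S \<Longrightarrow> \<tau> \<noteq> {}"
  using simplicial_complexD[OF simplicial(1)] by blast+

lemma finite_S: "finite (\<Union>S)"
  using simplicial(2) finite_simplex(1) by blast

lemma carrier: "\<tau> \<in> S \<Longrightarrow> \<exists>\<rho>\<in>K. \<forall>x\<in>\<tau>. pos x \<in> closed_simplex \<rho>"
  using sub unfolding subdivides_def by (elim conjE) (erule (1) bspec)

lemma strat_pos: "x \<in> \<Union>S \<Longrightarrow> strat pK (pos x) = p x"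
  using sub unfolding subdivides_def by (elim conjE) (erule (1) bspec)

lemma vertex_stratum_eq: "x \<in> \<Union>S \<Longrightarrow> p x = vertex_stratum pK x"
  using sub unfolding subdivides_def by (elim conjE) (erule (1) bspec)

lemma pos_in: "x \<in> \<Union>S \<Longrightarrow> pos x \<in> realization K"
proof -
  assume "x \<in> \<Union>S"
  then obtain \<tau> where \<tau>: "\<tau> \<in> S" "x \<in> \<tau>" by (rule UnionE)
  obtain \<rho> where \<rho>: "\<rho> \<in> K" "\<forall>x\<in>\<tau>. pos x \<in> closed_simplex \<rho>"
    using carrier[OF \<tau>(1)] ..
  show "pos x \<in> realization K"
    by (rule subsetD[OF closed_simplex_subset_realization[OF K(1) \<rho>(1)] bspec[OF \<rho>(2) \<tau>(2)]])
qed

lemma finite_supp_pos: "x \<in> \<Union>S \<Longrightarrow> finite (supp (pos x)) \<and> supp (pos x) \<noteq> {}"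
  using realization_finite_supp(1,2)[OF K(1) pos_in] by blast

lemma p_le: "x \<in> \<Union>S \<Longrightarrow> p x \<le> q"
proof -
  assume x: "x \<in> \<Union>S"
  have "Max (pK ` supp (pos x)) \<in> pK ` supp (pos x)"
    using finite_supp_pos[OF x] by (intro Max_in) auto
  then have "p x \<in> pK ` supp (pos x)"
    using strat_pos[OF x] unfolding strat_def by simp
  then obtain u where u: "u \<in> supp (pos x)" "p x = pK u" by (elim imageE)
  show "p x \<le> q"
    unfolding u(2) by (rule pK_le[OF subsetD[OF realization_finite_supp(3)[OF K(1) pos_in[OF x]] u(1)]])
qed

lemma subdiv_homeo_in:
  assumes t: "t \<in> realization S"
  shows "subdiv_homeo pos t \<in> realization K"
proof -
  obtain \<rho> where \<rho>: "\<rho> \<in> K" "\<forall>x\<in>supp t. pos x \<in> closed_simplex \<rho>"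
    using carrier[OF realizationD(2)[OF t]] ..
  have "subdiv_homeo pos t \<in> closed_simplex \<rho>"
    by (rule subdiv_homeo_in_closed_simplex[OF simplicial(1) t bspec[OF \<rho>(2)]])
  then show ?thesis
    using closed_simplex_subset_realization[OF K(1) \<rho>(1)] by blast
qed

lemma strat_subdiv_homeo_eq:
  assumes t: "t \<in> realization S"
  shows "strat pK (subdiv_homeo pos t) = strat p t"
proof (rule strat_subdiv_homeo[OF simplicial(1) t])
  fix w assume "w \<in> supp t"
  then have w: "w \<in> \<Union>S" by (rule subsetD[OF realization_finite_supp(3)[OF simplicial(1) t]])
  show "0 \<le> pos w u" for u using realizationD(1)[OF pos_in[OF w]] .
  show "finite (supp (pos w)) \<and> supp (pos w) \<noteq> {}" by (rule finite_supp_pos[OF w])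
  show "strat pK (pos w) = p w" by (rule strat_pos[OF w])
qed

lemma continuous_on_subdiv_homeo: "continuous_on (realization S) (subdiv_homeo pos)"
proof (rule continuous_on_coordinatewise_then_product)
  fix u
  have "continuous_on (realization S) (\<lambda>t. \<Sum>w\<in>\<Union>S. t w * pos w u)"
    by (intro continuous_on_sum continuous_on_mult_right continuous_on_subset[OF continuous_on_product_coordinates]) auto
  moreover have "(\<Sum>w\<in>\<Union>S. t w * pos w u) = subdiv_homeo pos t u" if "t \<in> realization S" for t
    by (rule subdiv_homeo_eq_sum[symmetric, OF finite_S realization_finite_supp(3)[OF simplicial(1) that]])
  ultimately show "continuous_on (realization S) (\<lambda>t. subdiv_homeo pos t u)"
    by (rule continuous_on_eq)
qed

text \<open>If \<open>v\<close> has the lowest stratum in \<open>supp x\<close>, then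
  \<open>good\<close> bounds the distance from \<open>v\<close> to every vertex of
  \<open>supp x\<close>, and by convexity to the point of \<open>K\<close> given by
  \<open>x\<close>. The choice of \<open>f v\<close> as a good position then yields
  \<open>star\<close>.\<close>

lemma ex_approximation:
  assumes good: "\<And>i. i \<le> q \<Longrightarrow> good i S p pos" and finL: "finite L"
  shows "\<exists>f. simplicial_map_strat S p L pL f \<and>
    strat_homotopic S p L pL (real_map f) (\<phi> \<circ> subdiv_homeo pos)"
proof -
  obtain D where D1: "\<And>i x. i \<le> q \<Longrightarrow> x \<in> \<Union>S \<Longrightarrow> p x = i \<Longrightarrow> \<exists>w. good_position i (D i) (pos x) w"
    and D2: "\<And>i \<tau> x y u. i \<le> q \<Longrightarrow> \<tau> \<in> S \<Longrightarrow> x \<in> \<tau> \<Longrightarrow> y \<in> \<tau> \<Longrightarrow> p x = i \<Longrightarrow> i \<le> p y \<Longrightarrow>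
        \<bar>pos x u - pos y u\<bar> \<le> D i"
    using good unfolding good_def by metis
  define f where "f x = (SOME w. good_position (p x) (D (p x)) (pos x) w)" for x
  have f: "good_position (p x) (D (p x)) (pos x) (f x)" if "x \<in> \<Union>S" for x
    unfolding f_def by (rule someI_ex) (use D1[OF p_le[OF that] that] in simp)
  interpret approximation q S p L pL "\<phi> \<circ> subdiv_homeo pos" f
  proof
    show "continuous_on (realization S) (\<phi> \<circ> subdiv_homeo pos)"
      by (rule continuous_on_compose[OF continuous_on_subdiv_homeo continuous_on_subset[OF cont_phi]])
        (use subdiv_homeo_in in blast)
    show "pL (f v) = p v" if "v \<in> \<Union>S" for v
      using f[OF that] by (simp add: good_position_def)
    fix v x
    assume x: "x \<in> realization S" and v: "v \<in> supp x" and low: "\<And>w. w \<in> supp x \<Longrightarrow> p v \<le> p w"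
    have vS: "v \<in> \<Union>S" by (rule UnionI[OF realizationD(2)[OF x] v])
    have "\<bar>subdiv_homeo pos x u - pos v u\<bar> \<le> D (p v)" for u
    proof (rule subdiv_homeo_close[OF simplicial(1) x])
      fix w assume w: "w \<in> supp x"
      show "\<bar>pos w u - pos v u\<bar> \<le> D (p v)"
        using D2[OF p_le[OF vS] realizationD(2)[OF x] v w refl low[OF w]] by (simp add: abs_minus_commute)
    qed
    then show "f v \<in> supp ((\<phi> \<circ> subdiv_homeo pos) x)"
      using f[OF vS] subdiv_homeo_in[OF x] unfolding good_position_def by simp
  qed (use simplicial L finL p_le subdiv_homeo_in phi_in strat_phi strat_subdiv_homeo_eq in simp_all)
  show ?thesis using simplicial_map strat_homotopic by blast
qed

end

section \<open>Effect of one relative subdivision\<close>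

context
  fixes S p pos j A S' p' pos'
  assumes sub: "subdivides S p pos" and A: "A = {w \<in> \<Union>S. p w < j}"
    and step: "sd_step (S, p, pos) A = (S', p', pos')"
begin

lemma S'_eq: "S' = sd_rel S A"
  using step by (simp add: sd_step_def)

lemma p'_old: "w \<in> A \<Longrightarrow> p' w = p w" and pos'_old: "w \<in> A \<Longrightarrow> pos' w = pos w"
  using step by (auto simp: sd_step_def)

lemma high: "\<tau> \<in> S \<Longrightarrow> \<tau> \<inter> A = {} \<Longrightarrow> x \<in> \<tau> \<Longrightarrow> j \<le> p x"
  unfolding A by force

lemma Max_high:
  assumes "\<tau> \<in> S" "\<tau> \<inter> A = {}"
  shows "j \<le> Max (p ` \<tau>)"
proof -
  obtain x where "x \<in> \<tau>" using finite_simplex(2)[OF sub assms(1)] by blast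
  then have "j \<le> p x" "p x \<le> Max (p ` \<tau>)"
    using high[OF assms] finite_simplex(1)[OF sub assms(1)] by auto
  then show ?thesis by linarith
qed

lemma vertex_stratum_bary:
  assumes "\<tau> \<in> S"
  shows "vertex_stratum pK (bary \<tau>) = Max (p ` \<tau>)"
proof -
  have "p x = vertex_stratum pK x" if "x \<in> \<tau>" for x
    using vertex_stratum_eq[OF sub] that assms by blast
  then have "p ` \<tau> = vertex_stratum pK ` \<tau>" by (rule image_cong[OF refl])
  then show ?thesis
    by (simp add: fimage.rep_eq fset_Abs_fset finite_simplex(1)[OF sub assms])
qed

text \<open>A kept vertex may be a barycenter from an earlier round, so the constructors do not
  separate old from new. The strata do: below \<open>j\<close> on \<open>A\<close>, at least
  \<open>j\<close> for a simplex disjoint from \<open>A\<close>.\<close>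

lemma bary_notin:
  assumes "\<tau> \<in> S" "\<tau> \<inter> A = {}"
  shows "bary \<tau> \<notin> A"
proof
  assume "bary \<tau> \<in> A"
  then have "bary \<tau> \<in> \<Union>S" "p (bary \<tau>) < j" unfolding A by auto
  then show False
    using vertex_stratum_eq[OF sub] vertex_stratum_bary[OF assms(1)] Max_high[OF assms] by fastforce
qed

lemma p'_bary: "p' (bary \<tau>) = Max (p ` \<tau>)"
  and pos'_bary: "pos' (bary \<tau>) = subdiv_homeo pos (barycenter \<tau>)"
  if "\<tau> \<in> S" "\<tau> \<inter> A = {}"
  using step bary_notin[OF that] finite_simplex(1)[OF sub that(1)]
  by (auto simp: sd_step_def fset_Abs_fset subdiv_homeo_barycenter)

lemma barycenter_in: "\<tau> \<in> S \<Longrightarrow> barycenter \<tau> \<in> realization S"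
  by (rule barycenter_in_realization[OF simplicial(1)[OF sub]])

lemma supp_barycenter_eq: "\<tau> \<in> S \<Longrightarrow> supp (barycenter \<tau>) = \<tau>"
  by (rule supp_barycenter[OF finite_simplex(1)[OF sub]])

lemma vertex_cases:
  assumes "\<sigma> \<in> S'" "w \<in> \<sigma>"
  obtains (old) "w \<in> A" | (new) \<tau> where "\<tau> \<in> S" "\<tau> \<inter> A = {}" "w = bary \<tau>"
proof -
  obtain \<rho> T where T: "\<And>\<tau>. \<tau> \<in> T \<Longrightarrow> \<tau> \<in> S \<and> \<tau> \<subseteq> \<rho> \<and> \<tau> \<inter> A = {}" "\<sigma> \<subseteq> \<rho> \<inter> A \<union> bary ` T"
    using sd_relE[OF assms(1)[unfolded S'_eq]] by metis
  have "w \<in> \<rho> \<inter> A \<union> bary ` T" by (rule subsetD[OF T(2) assms(2)])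
  then show ?thesis
  proof
    assume "w \<in> bary ` T"
    then obtain \<tau> where \<tau>: "w = bary \<tau>" "\<tau> \<in> T" by (rule imageE)
    show ?thesis using T(1)[OF \<tau>(2)] \<tau>(1) by (intro new) simp_all
  qed (simp add: old)
qed

lemma old_vertex: "w \<in> A \<Longrightarrow> w \<in> \<Union>S'"
proof -
  assume w: "w \<in> A"
  then obtain \<tau> where "\<tau> \<in> S" "w \<in> \<tau>" unfolding A by blast
  then have "{w} \<in> S" by (intro simplicial_complexD(3)[OF simplicial(1)[OF sub] \<open>\<tau> \<in> S\<close>]) simp_all
  then have "{w} \<union> bary ` {} \<in> sd_rel S A"
    unfolding sd_rel_def mem_Collect_eq using w by (intro exI[of _ "{w}"] exI[of _ "{}"]) simp
  then show ?thesis unfolding S'_eq by auto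
qed

text \<open>The next round is thus again relative to the full subcomplex on the strata below
  \<open>j\<close>, with the same vertex set \<open>A\<close>.\<close>

lemma low_eq: "A = {w \<in> \<Union>S'. p' w < j}"
proof
  show "A \<subseteq> {w \<in> \<Union>S'. p' w < j}"
  proof
    fix w assume w: "w \<in> A"
    then have "p w < j" unfolding A by blast
    then show "w \<in> {w \<in> \<Union>S'. p' w < j}" using old_vertex[OF w] p'_old[OF w] by simp
  qed
  show "{w \<in> \<Union>S'. p' w < j} \<subseteq> A"
  proof
    fix w assume "w \<in> {w \<in> \<Union>S'. p' w < j}"
    then obtain \<sigma> where w: "\<sigma> \<in> S'" "w \<in> \<sigma>" "p' w < j" by blast
    from w(1,2) show "w \<in> A"
    proof (cases rule: vertex_cases)
      case (new \<tau>)
      then show ?thesis using p'_bary[of \<tau>] Max_high[of \<tau>] w(3) by simp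
    qed
  qed
qed

lemma subdivides_step: "subdivides S' p' pos'"
  unfolding subdivides_def
proof (intro conjI ballI)
  show "simplicial_complex S'" "finite S'"
    unfolding S'_eq
    by (rule simplicial_complex_sd_rel[OF simplicial(1)[OF sub]],
        rule finite_sd_rel[OF simplicial(2)[OF sub] finite_S[OF sub]])
  fix \<sigma> assume \<sigma>: "\<sigma> \<in> S'"
  obtain \<rho> T where \<rho>: "\<rho> \<in> S" and T: "\<And>\<tau>. \<tau> \<in> T \<Longrightarrow> \<tau> \<in> S \<and> \<tau> \<subseteq> \<rho> \<and> \<tau> \<inter> A = {}"
    and sub\<sigma>: "\<sigma> \<subseteq> \<rho> \<inter> A \<union> bary ` T"
    using sd_relE[OF \<sigma>[unfolded S'_eq]] by metis
  obtain \<kappa> where \<kappa>: "\<kappa> \<in> K" "\<forall>x\<in>\<rho>. pos x \<in> closed_simplex \<kappa>"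
    using carrier[OF sub \<rho>] ..
  have "pos' w \<in> closed_simplex \<kappa>" if "w \<in> \<sigma>" for w
  proof -
    have "w \<in> \<rho> \<inter> A \<or> w \<in> bary ` T" using that sub\<sigma> by blast
    then show ?thesis
    proof
      assume "w \<in> bary ` T"
      then obtain \<tau> where \<tau>: "\<tau> \<in> T" "w = bary \<tau>" by blast
      note T = T[OF \<tau>(1)]
      show ?thesis
        unfolding \<tau>(2)
      proof (subst pos'_bary)
        show \<tau>S: "\<tau> \<in> S" "\<tau> \<inter> A = {}" using T by simp_all
        show "subdiv_homeo pos (barycenter \<tau>) \<in> closed_simplex \<kappa>"
        proof (rule subdiv_homeo_in_closed_simplex[OF simplicial(1)[OF sub] barycenter_in[OF \<tau>S(1)]])
          fix x assume "x \<in> supp (barycenter \<tau>)"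
          then have "x \<in> \<rho>" using supp_barycenter_eq[OF \<tau>S(1)] T by blast
          then show "pos x \<in> closed_simplex \<kappa>" using \<kappa>(2) by simp
        qed
      qed
    next
      assume "w \<in> \<rho> \<inter> A"
      then show ?thesis using \<kappa>(2) pos'_old by simp
    qed
  qed
  then show "\<exists>\<rho>\<in>K. \<forall>x\<in>\<sigma>. pos' x \<in> closed_simplex \<rho>" using \<kappa>(1) by blast
next
  fix w assume "w \<in> \<Union>S'"
  then obtain \<sigma> where w: "\<sigma> \<in> S'" "w \<in> \<sigma>" by blast
  have "strat pK (pos' w) = p' w \<and> p' w = vertex_stratum pK w"
    using w
  proof (cases rule: vertex_cases)
    case old
    then have "w \<in> \<Union>S" unfolding A by blast
    then show ?thesis
      using strat_pos[OF sub] vertex_stratum_eq[OF sub] p'_old[OF old] pos'_old[OF old] by simp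
  next
    case (new \<tau>)
    have "strat pK (pos' w) = strat p (barycenter \<tau>)"
      unfolding new(3) pos'_bary[OF new(1,2)]
      by (rule strat_subdiv_homeo_eq[OF sub barycenter_in[OF new(1)]])
    also have "\<dots> = Max (p ` \<tau>)"
      unfolding strat_def supp_barycenter_eq[OF new(1)] ..
    finally show ?thesis
      using p'_bary[OF new(1,2)] vertex_stratum_bary[OF new(1)] new(3) by simp
  qed
  then show "strat pK (pos' w) = p' w" "p' w = vertex_stratum pK w" by simp_all
qed

lemma low_vertex_old:
  assumes "w \<in> \<Union>S'" "p' w < j"
  shows "w \<in> A" "w \<in> \<Union>S" "p' w = p w" "pos' w = pos w"
proof -
  show w: "w \<in> A" using assms unfolding low_eq by blast
  then show "w \<in> \<Union>S" unfolding A by blast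
  show "p' w = p w" "pos' w = pos w" using p'_old[OF w] pos'_old[OF w] .
qed

lemma good_step:
  assumes "i < j" "good i S p pos"
  shows "good i S' p' pos'"
proof -
  obtain D where D1: "\<forall>x\<in>\<Union>S. p x = i \<longrightarrow> (\<exists>w. good_position i D (pos x) w)"
    and D2: "\<forall>\<tau>\<in>S. \<forall>x\<in>\<tau>. \<forall>y\<in>\<tau>. p x = i \<longrightarrow> i \<le> p y \<longrightarrow> (\<forall>u. \<bar>pos x u - pos y u\<bar> \<le> D)"
    using assms(2) unfolding good_def by blast
  have "\<exists>w. good_position i D (pos' x) w" if "x \<in> \<Union>S'" "p' x = i" for x
  proof -
    have "p' x < j" using that(2) assms(1) by simp
    note x = low_vertex_old[OF that(1) this]
    show ?thesis using bspec[OF D1 x(2)] x(3,4) that(2) by simp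
  qed
  moreover have "\<bar>pos' x u - pos' y u\<bar> \<le> D"
    if \<sigma>: "\<sigma> \<in> S'" "x \<in> \<sigma>" "y \<in> \<sigma>" "p' x = i" "i \<le> p' y" for \<sigma> x y u
  proof -
    have "x \<in> \<Union>S'" "p' x < j" using \<sigma>(1,2,4) assms(1) by auto
    note x = low_vertex_old[OF this]
    obtain \<rho> T where \<rho>: "\<rho> \<in> S" and T: "\<And>\<tau>. \<tau> \<in> T \<Longrightarrow> \<tau> \<in> S \<and> \<tau> \<subseteq> \<rho> \<and> \<tau> \<inter> A = {}"
      and sub\<sigma>: "\<sigma> \<subseteq> \<rho> \<inter> A \<union> bary ` T"
      using sd_relE[OF \<sigma>(1)[unfolded S'_eq]] by metis
    \<comment> \<open>A vertex of stratum \<open>i < j\<close> is kept and cannot be a new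
      barycenter, so it shares \<open>\<rho>\<close> with \<open>y\<close> or with the simplex that
      \<open>y\<close> averages.\<close>
    have x\<rho>: "x \<in> \<rho>"
    proof -
      have "x \<notin> bary ` T" using x(1) bary_notin T by blast
      then show ?thesis using \<sigma>(2) sub\<sigma> by blast
    qed
    have px: "p x = i" using x(3) \<sigma>(4) by simp
    have d: "\<bar>pos y u - pos x u\<bar> \<le> D" if "y \<in> \<rho>" "i \<le> p y" for y
      using D2[rule_format, OF \<rho> x\<rho> that(1) px that(2), of u] by (simp add: abs_minus_commute)
    have "y \<in> \<rho> \<inter> A \<or> y \<in> bary ` T" using \<sigma>(3) sub\<sigma> by blast
    then have "\<bar>pos' y u - pos' x u\<bar> \<le> D"
    proof
      assume "y \<in> \<rho> \<inter> A"
      then show ?thesis using d[of y] \<sigma>(5) x(4) p'_old[of y] pos'_old[of y] by simp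
    next
      assume "y \<in> bary ` T"
      then obtain \<tau> where \<tau>: "\<tau> \<in> T" "y = bary \<tau>" by blast
      note T = T[OF \<tau>(1)]
      have "\<bar>subdiv_homeo pos (barycenter \<tau>) u - pos x u\<bar> \<le> D"
      proof (rule subdiv_homeo_close[OF simplicial(1)[OF sub] barycenter_in])
        show "\<tau> \<in> S" using T by blast
        fix w assume "w \<in> supp (barycenter \<tau>)"
        then have w: "w \<in> \<tau>" using supp_barycenter_eq T by blast
        then have "i \<le> p w" using high[of \<tau> w] T assms(1) by simp
        then show "\<bar>pos w u - pos x u\<bar> \<le> D" using d[of w] w T by blast
      qed
      then show ?thesis using pos'_bary[of \<tau>] T \<tau>(2) x(4) by simp
    qed
    then show ?thesis by (simp add: abs_minus_commute)
  qed
  ultimately show ?thesis unfolding good_def by blast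
qed

text \<open>A vertex of stratum \<open>j\<close> created here is the barycenter of some
  \<open>\<tau>\<close> whose vertices have stratum at least \<open>j\<close> and maximum
  \<open>j\<close>, hence all have stratum exactly \<open>j\<close>; the bound passes to their
  average.\<close>

lemma mass_step:
  assumes "\<And>x. x \<in> \<Union>S \<Longrightarrow> p x = j \<Longrightarrow> \<epsilon> \<le> mass_in j (pos x)" and w: "w \<in> \<Union>S'" "p' w = j"
  shows "\<epsilon> \<le> mass_in j (pos' w)"
proof -
  obtain \<sigma> where \<sigma>: "\<sigma> \<in> S'" "w \<in> \<sigma>" using w(1) by blast
  then show ?thesis
  proof (cases rule: vertex_cases)
    case old
    then have "p' w < j" unfolding low_eq by blast
    then show ?thesis using w(2) by simp
  next
    case (new \<tau>)
    show ?thesis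
      unfolding new(3) pos'_bary[OF new(1,2)]
    proof (rule sum_subdiv_homeo_ge[OF simplicial(1)[OF sub] barycenter_in[OF new(1)]])
      fix x assume "x \<in> supp (barycenter \<tau>)"
      then have x: "x \<in> \<tau>" using supp_barycenter_eq[OF new(1)] by blast
      have "p x \<le> Max (p ` \<tau>)" using x finite_simplex(1)[OF sub new(1)] by simp
      then have "p x = j"
        using high[OF new(1,2) x] p'_bary[OF new(1,2)] w(2) new(3) by simp
      then show "\<epsilon> \<le> mass_in j (pos x)" using assms(1) x new(1) by blast
    qed
  qed
qed

text \<open>Two adjacent vertices off \<open>A\<close> are barycenters of nested simplices disjoint
  from \<open>A\<close>, to which \<open>barycenters_close\<close> applies.\<close>

lemma mesh_step:
  assumes card: "\<And>\<tau>. \<tau> \<in> S \<Longrightarrow> \<tau> \<inter> A = {} \<Longrightarrow> card \<tau> \<le> N"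
    and mesh: "\<And>\<tau> x y u. \<tau> \<in> S \<Longrightarrow> x \<in> \<tau> \<Longrightarrow> y \<in> \<tau> \<Longrightarrow> x \<notin> A \<Longrightarrow> y \<notin> A \<Longrightarrow> \<bar>pos x u - pos y u\<bar> \<le> D"
    and \<sigma>: "\<sigma> \<in> S'" "x \<in> \<sigma>" "y \<in> \<sigma>" "x \<notin> A" "y \<notin> A"
  shows "\<bar>pos' x u - pos' y u\<bar> \<le> (1 - 1 / real N) * D"
proof -
  obtain \<rho> T where \<rho>: "\<rho> \<in> S" and T: "\<And>\<tau>. \<tau> \<in> T \<Longrightarrow> \<tau> \<in> S \<and> \<tau> \<subseteq> \<rho> \<and> \<tau> \<inter> A = {}"
    and chain: "\<And>\<tau> \<tau>'. \<tau> \<in> T \<Longrightarrow> \<tau>' \<in> T \<Longrightarrow> \<tau> \<subseteq> \<tau>' \<or> \<tau>' \<subseteq> \<tau>"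
    and sub\<sigma>: "\<sigma> \<subseteq> \<rho> \<inter> A \<union> bary ` T"
    using sd_relE[OF \<sigma>(1)[unfolded S'_eq]] by metis
  obtain \<tau> where \<tau>: "\<tau> \<in> T" "x = bary \<tau>" using \<sigma>(2,4) sub\<sigma> by blast
  obtain \<tau>' where \<tau>': "\<tau>' \<in> T" "y = bary \<tau>'" using \<sigma>(3,5) sub\<sigma> by blast
  have close: "\<bar>subdiv_homeo pos (barycenter \<kappa>) u - subdiv_homeo pos (barycenter \<kappa>') u\<bar> \<le> (1 - 1 / real N) * D"
    if "\<kappa> \<in> T" "\<kappa>' \<in> T" "\<kappa> \<subseteq> \<kappa>'" for \<kappa> \<kappa>'
  proof (rule barycenters_close[OF simplicial(1)[OF sub]])
    show "\<kappa>' \<in> S" "\<kappa> \<in> S" using T that by blast+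
    show "card \<kappa>' \<le> N" using card[of \<kappa>'] T[OF that(2)] by blast
    show "\<bar>pos a u - pos b u\<bar> \<le> D" if "a \<in> \<kappa>'" "b \<in> \<kappa>'" for a b
      using mesh[of \<kappa>' a b u] T[OF \<open>\<kappa>' \<in> T\<close>] that by blast
  qed (rule that(3))
  have "\<bar>subdiv_homeo pos (barycenter \<tau>) u - subdiv_homeo pos (barycenter \<tau>') u\<bar> \<le> (1 - 1 / real N) * D"
    using chain[OF \<tau>(1) \<tau>'(1)] close[OF \<tau>(1) \<tau>'(1)] close[OF \<tau>'(1) \<tau>(1)]
    by (auto simp: abs_minus_commute)
  then show ?thesis
    using pos'_bary[of \<tau>] pos'_bary[of \<tau>'] T[OF \<tau>(1)] T[OF \<tau>'(1)] \<tau>(2) \<tau>'(2) by simp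
qed

end

lemma stage_step:
  assumes "stage N \<epsilon> j A D X"
  shows "stage N \<epsilon> j A ((1 - 1 / real N) * D) (sd_step X A)"
proof -
  obtain S p pos where X: "X = (S, p, pos)" by (cases X)
  obtain S' p' pos' where X': "sd_step X A = (S', p', pos')" by (cases "sd_step X A")
  have sub: "subdivides S p pos" and A: "A = {w \<in> \<Union>S. p w < j}"
    and good: "\<And>i. i < j \<Longrightarrow> good i S p pos"
    and card: "\<And>\<tau>. \<tau> \<in> S \<Longrightarrow> \<tau> \<inter> A = {} \<Longrightarrow> card \<tau> \<le> N"
    and mass: "\<And>x. x \<in> \<Union>S \<Longrightarrow> p x = j \<Longrightarrow> \<epsilon> \<le> mass_in j (pos x)"
    and mesh: "\<And>\<tau> x y u. \<tau> \<in> S \<Longrightarrow> x \<in> \<tau> \<Longrightarrow> y \<in> \<tau> \<Longrightarrow> x \<notin> A \<Longrightarrow> y \<notin> A \<Longrightarrow> \<bar>pos x u - pos y u\<bar> \<le> D"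
    using assms unfolding stage_def X prod.case by blast+
  note st = sub A X'[unfolded X]
  show ?thesis
    unfolding X' stage_def prod.case
  proof (intro conjI allI impI ballI)
    show "subdivides S' p' pos'" by (rule subdivides_step[OF st])
    show "A = {w \<in> \<Union>S'. p' w < j}" by (rule low_eq[OF st])
    show "good i S' p' pos'" if "i < j" for i
      by (rule good_step[OF st that good[OF that]])
    show "card \<tau> \<le> N" if "\<tau> \<in> S'" "\<tau> \<inter> A = {}" for \<tau>
      by (rule card_sd_rel_le[OF simplicial(1)[OF sub] that(1)[unfolded S'_eq[OF st]] that(2) card])
    show "\<epsilon> \<le> mass_in j (pos' x)" if "x \<in> \<Union>S'" "p' x = j" for x
      by (rule mass_step[OF st mass that])
    show "\<bar>pos' x u - pos' y u\<bar> \<le> (1 - 1 / real N) * D"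
      if "\<tau> \<in> S'" "x \<in> \<tau>" "y \<in> \<tau>" "x \<notin> A" "y \<notin> A" for \<tau> x y u
      by (rule mesh_step[OF st card mesh that])
  qed
qed

lemma stage_iterate:
  assumes "stage N \<epsilon> j A D X"
  shows "stage N \<epsilon> j A ((1 - 1 / real N) ^ m * D) (((\<lambda>Y. sd_step Y A) ^^ m) X)"
proof (induction m)
  case 0
  then show ?case using assms by simp
next
  case (Suc m)
  then show ?case using stage_step[OF Suc] by (simp add: mult.assoc)
qed


section \<open>A Lebesgue number for one stratum\<close>

text \<open>The admissible points \<open>c\<close> form a compact set \<open>C\<close>, the
  conditions being closed, and lie in stratum \<open>j\<close>: nothing lies above it and, as
  \<open>\<epsilon> > 0\<close>, some weight lies in it. Since \<open>\<phi>\<close> preserves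
  strata, \<open>supp (\<phi> c)\<close> has a vertex of stratum \<open>j\<close>, which stays in
  the support near \<open>c\<close>.\<close>

lemma ex_uniform_position:
  assumes \<epsilon>: "0 < \<epsilon>"
  shows "\<exists>\<delta>>0. \<forall>c\<in>realization K. (\<forall>u. j < pK u \<longrightarrow> c u = 0) \<longrightarrow> \<epsilon> \<le> mass_in j c \<longrightarrow>
    (\<exists>w. good_position j \<delta> c w)"
proof -
  define C where "C = realization K \<inter> ((\<Inter>u\<in>{u. j < pK u}. {c. c u = 0}) \<inter> {c. \<epsilon> \<le> mass_in j c})"
  have "closed ((\<Inter>u\<in>{u. j < pK u}. {c. c u = 0}) \<inter> {c :: 'v \<Rightarrow> real. \<epsilon> \<le> mass_in j c})"
    by (intro closed_Int closed_INT ballI closed_Collect_eq closed_Collect_le continuous_on_sum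
        continuous_on_const continuous_on_product_coordinates)
  then have C: "compact C"
    unfolding C_def by (rule compact_Int_closed[OF compact_realization[OF K]])
  \<comment> \<open>The radius \<open>2 * d\<close> leaves room for two steps of length
    \<open>d\<close>: from the centre of a covering box to \<open>c\<close>, and from
    \<open>c\<close> to \<open>y\<close>.\<close>
  have "\<exists>w d. 0 < d \<and> pL w = j \<and> (\<forall>y\<in>realization K. (\<forall>u. \<bar>y u - c u\<bar> < 2 * d) \<longrightarrow> \<phi> y w \<noteq> 0)"
    if "c \<in> C" for c
  proof -
    have c: "c \<in> realization K" "\<epsilon> \<le> mass_in j c" and up: "\<And>u. j < pK u \<Longrightarrow> c u = 0"
      using that by (simp_all add: C_def)
    have "\<exists>u\<in>{u \<in> \<Union>K. pK u = j}. c u \<noteq> 0"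
    proof (rule ccontr)
      assume "\<not> ?thesis"
      then have "mass_in j c = 0" by (intro sum.neutral) blast
      then show False using c(2) \<epsilon> by simp
    qed
    then obtain u where u: "c u \<noteq> 0" "pK u = j" by blast
    have "strat pK c = j"
      unfolding strat_def
    proof (rule Max_eqI)
      show "finite (pK ` supp c)" using realization_finite_supp(1)[OF K(1) c(1)] by (rule finite_imageI)
      show "j \<in> pK ` supp c" using u by (intro image_eqI[of _ _ u]) simp_all
      show "k \<le> j" if "k \<in> pK ` supp c" for k
      proof -
        obtain v where "v \<in> supp c" "k = pK v" using \<open>k \<in> pK ` supp c\<close> by (elim imageE)
        then show ?thesis using up[of v] by (cases "j < pK v") simp_all
      qed
    qed
    then have "Max (pL ` supp (\<phi> c)) = j" using strat_phi[OF c(1)] by (simp add: strat_def)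
    moreover have "Max (pL ` supp (\<phi> c)) \<in> pL ` supp (\<phi> c)"
      using realization_finite_supp(1,2)[OF L phi_in[OF c(1)]] by (intro Max_in finite_imageI) simp_all
    ultimately have "j \<in> pL ` supp (\<phi> c)" by simp
    then obtain w where w: "w \<in> supp (\<phi> c)" "j = pL w" by (rule imageE)
    have "continuous_on (realization K) (\<lambda>y. \<phi> y w)"
      using cont_phi by (rule continuous_on_product_then_coordinatewise)
    moreover have "open (- {0::real})" by (rule open_Compl[OF closed_singleton])
    ultimately obtain W where W: "open W" "W \<inter> realization K = (\<lambda>y. \<phi> y w) -` (- {0}) \<inter> realization K"
      unfolding continuous_on_open_invariant by metis
    have W_iff: "y \<in> W \<longleftrightarrow> \<phi> y w \<noteq> 0" if "y \<in> realization K" for y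
    proof -
      have "y \<in> W \<longleftrightarrow> y \<in> W \<inter> realization K" using that by simp
      then show ?thesis unfolding W(2) using that by simp
    qed
    have "c \<in> W" using W_iff[OF c(1)] w(1) by simp
    then obtain d where d: "0 < d" "\<And>y. (\<And>u. \<bar>y u - c u\<bar> < d) \<Longrightarrow> y \<in> W"
      using box_neighbourhood[OF W(1)] by metis
    have "\<phi> y w \<noteq> 0" if "y \<in> realization K" "\<forall>u. \<bar>y u - c u\<bar> < 2 * (d / 2)" for y
      using d(2)[of y] W_iff[OF that(1)] that(2) by simp
    then show ?thesis
      using d(1) w(2) by (intro exI[of _ w] exI[of _ "d / 2"]) simp
  qed
  then obtain w d where wd: "\<And>c. c \<in> C \<Longrightarrow> 0 < d c" "\<And>c. c \<in> C \<Longrightarrow> pL (w c) = j"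
    "\<And>c y. c \<in> C \<Longrightarrow> y \<in> realization K \<Longrightarrow> (\<forall>u. \<bar>y u - c u\<bar> < 2 * d c) \<Longrightarrow> \<phi> y (w c) \<noteq> 0"
    by metis
  \<comment> \<open>Only finitely many coordinates are restricted, which makes \<open>B c\<close>
    open; the others vanish on the realization of \<open>K\<close>.\<close>
  define B where "B c = (\<Inter>u\<in>\<Union>K. {y. \<bar>y u - c u\<bar> < d c})" for c
  have "open (B c)" for c
    unfolding B_def using finite_K
    by (intro open_INT ballI open_Collect_less continuous_on_rabs continuous_on_diff
        continuous_on_const continuous_on_product_coordinates)
  moreover have "C \<subseteq> (\<Union>c\<in>C. B c)" using wd(1) unfolding B_def by fastforce
  ultimately obtain C' where C': "C' \<subseteq> C" "finite C'" "C \<subseteq> (\<Union>c\<in>C'. B c)"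
    using compactE_image[OF C, of C B] by metis
  define \<delta> where "\<delta> = Min (insert 1 (d ` C'))"
  have "0 < \<delta>" unfolding \<delta>_def using C'(1,2) wd(1) by (subst Min_gr_iff) auto
  moreover have "\<exists>w. good_position j \<delta> c w"
    if c: "c \<in> realization K" "\<And>u. j < pK u \<Longrightarrow> c u = 0" "\<epsilon> \<le> mass_in j c" for c
  proof -
    have "c \<in> C" using c by (simp add: C_def)
    then obtain c' where c': "c' \<in> C'" "c \<in> B c'" using C'(3) by blast
    then have "c' \<in> C" using C'(1) by blast
    then have c'K: "c' \<in> realization K" by (simp add: C_def)
    have "\<delta> \<le> d c'" unfolding \<delta>_def using C'(2) c'(1) by (intro Min_le) auto
    have "\<bar>y u - c' u\<bar> < 2 * d c'" if y: "y \<in> realization K" "\<forall>u. \<bar>y u - c u\<bar> \<le> \<delta>" for y u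
    proof (cases "u \<in> \<Union>K")
      case True
      then have "\<bar>c u - c' u\<bar> < d c'" using c'(2) unfolding B_def by blast
      moreover have "\<bar>y u - c u\<bar> \<le> \<delta>" using y(2) by simp
      ultimately show ?thesis using \<open>\<delta> \<le> d c'\<close> by linarith
    next
      case False
      then have "y u = 0" "c' u = 0"
        using realization_finite_supp(3)[OF K(1) y(1)] realization_finite_supp(3)[OF K(1) c'K] by auto
      then show ?thesis using wd(1)[OF \<open>c' \<in> C\<close>] by simp
    qed
    then have "good_position j \<delta> c (w c')"
      unfolding good_position_def using wd(2,3)[OF \<open>c' \<in> C\<close>] by simp
    then show ?thesis ..
  qed
  ultimately show ?thesis by blast
qed

section \<open>Choosing the numbers of subdivisions\<close>

text \<open>The order of choices matters: \<open>N\<close> and \<open>\<epsilon>\<close> come from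
  the given complex, \<open>\<delta>\<close> from \<open>\<epsilon>\<close>, and \<open>m\<close>
  from \<open>N\<close> and \<open>\<delta>\<close>. The iteration preserves
  \<open>\<epsilon>\<close>, so \<open>\<delta>\<close> is still valid after \<open>m\<close>
  rounds.\<close>

lemma ex_stage:
  assumes sub: "subdivides S p pos" and A: "A = {w \<in> \<Union>S. p w < j}"
    and good: "\<And>i. i < j \<Longrightarrow> good i S p pos"
  shows "\<exists>m S' p' pos'. ((\<lambda>Y. sd_step Y A) ^^ m) (S, p, pos) = (S', p', pos') \<and>
    subdivides S' p' pos' \<and> (\<forall>i\<le>j. good i S' p' pos')"
proof -
  define N where "N = Max (insert 1 (card ` S))"
  define \<epsilon> where "\<epsilon> = Min (insert 1 ((\<lambda>x. mass_in j (pos x)) ` {x \<in> \<Union>S. p x = j}))"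
  have finS: "finite {x \<in> \<Union>S. p x = j}"
    by (rule finite_subset[OF _ finite_S[OF sub]]) blast
  have "0 < mass_in j (pos x)" if x: "x \<in> \<Union>S" "p x = j" for x
  proof -
    have "Max (pK ` supp (pos x)) \<in> pK ` supp (pos x)"
      using finite_supp_pos[OF sub x(1)] by (intro Max_in) auto
    then have "j \<in> pK ` supp (pos x)"
      using strat_pos[OF sub x(1)] x(2) unfolding strat_def by simp
    then obtain u where u: "u \<in> supp (pos x)" "j = pK u" by (rule imageE)
    have u': "u \<in> {u \<in> \<Union>K. pK u = j}"
      using subsetD[OF realization_finite_supp(3)[OF K(1) pos_in[OF sub x(1)]] u(1)] u(2) by simp
    have fin: "finite {u \<in> \<Union>K. pK u = j}"
      by (rule finite_subset[OF _ finite_K]) blast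
    have "0 < pos x u"
      using u(1) realizationD(1)[OF pos_in[OF sub x(1)], of u] by simp
    then show ?thesis
      by (rule sum_pos2[OF fin u']) (rule realizationD(1)[OF pos_in[OF sub x(1)]])
  qed
  then have "0 < \<epsilon>" unfolding \<epsilon>_def using finS by (subst Min_gr_iff) auto
  then obtain \<delta> where \<delta>: "0 < \<delta>"
    "\<forall>c\<in>realization K. (\<forall>u. j < pK u \<longrightarrow> c u = 0) \<longrightarrow> \<epsilon> \<le> mass_in j c \<longrightarrow> (\<exists>w. good_position j \<delta> c w)"
    using ex_uniform_position[of \<epsilon> j] by blast
  \<comment> \<open>The initial mesh is at most 1, since coordinates in a realization lie between 0
    and 1.\<close>
  have "stage N \<epsilon> j A 1 (S, p, pos)"
    unfolding stage_def prod.case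
  proof (intro conjI allI impI ballI sub A good)
    show "card \<tau> \<le> N" if "\<tau> \<in> S" for \<tau>
      unfolding N_def using simplicial(2)[OF sub] that by (intro Max_ge) simp_all
    show "\<epsilon> \<le> mass_in j (pos x)" if "x \<in> \<Union>S" "p x = j" for x
      unfolding \<epsilon>_def using finS that by (intro Min_le) auto
    show "\<bar>pos x u - pos y u\<bar> \<le> 1" if "\<tau> \<in> S" "x \<in> \<tau>" "y \<in> \<tau>" for \<tau> x y u
    proof -
      have "pos x \<in> realization K" "pos y \<in> realization K"
        using that by (auto intro: pos_in[OF sub])
      then show ?thesis
        using realization_le_1[OF K(1), of _ u] realizationD(1)[of _ K u] by (smt (verit))
    qed
  qed
  note st = stage_iterate[OF this]
  have "1 \<le> N" unfolding N_def using simplicial(2)[OF sub] by (intro Max_ge) simp_all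
  then have "1 - 1 / real N < 1" by simp
  then obtain m where m: "(1 - 1 / real N) ^ m < \<delta>"
    using real_arch_pow_inv[OF \<delta>(1)] by blast
  obtain S' p' pos' where X: "((\<lambda>Y. sd_step Y A) ^^ m) (S, p, pos) = (S', p', pos')"
    by (rule prod_cases3)
  have sub': "subdivides S' p' pos'" and A': "A = {w \<in> \<Union>S'. p' w < j}"
    and good': "\<And>i. i < j \<Longrightarrow> good i S' p' pos'"
    and mass': "\<And>x. x \<in> \<Union>S' \<Longrightarrow> p' x = j \<Longrightarrow> \<epsilon> \<le> mass_in j (pos' x)"
    and mesh': "\<And>\<tau> x y u. \<tau> \<in> S' \<Longrightarrow> x \<in> \<tau> \<Longrightarrow> y \<in> \<tau> \<Longrightarrow> x \<notin> A \<Longrightarrow> y \<notin> A \<Longrightarrow>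
      \<bar>pos' x u - pos' y u\<bar> \<le> (1 - 1 / real N) ^ m * 1"
    using st[of m] unfolding X stage_def prod.case by blast+
  have "good j S' p' pos'"
    unfolding good_def
  proof (intro exI[of _ \<delta>] conjI ballI impI allI)
    fix x assume x: "x \<in> \<Union>S'" "p' x = j"
    show "\<exists>w. good_position j \<delta> (pos' x) w"
    proof (rule \<delta>(2)[rule_format, OF pos_in[OF sub' x(1)] _ mass'[OF x]])
      fix u assume u: "j < pK u"
      show "pos' x u = 0"
      proof (rule ccontr)
        assume "pos' x u \<noteq> 0"
        then have "pK u \<le> strat pK (pos' x)"
          unfolding strat_def using finite_supp_pos[OF sub' x(1)] by (intro Max_ge) simp_all
        then show False using strat_pos[OF sub' x(1)] x(2) u by simp
      qed
    qed
  next
    fix \<tau> x y u assume "\<tau> \<in> S'" "x \<in> \<tau>" "y \<in> \<tau>" "p' x = j" "j \<le> p' y"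
    then have "\<bar>pos' x u - pos' y u\<bar> \<le> (1 - 1 / real N) ^ m * 1"
      by (intro mesh') (simp_all add: A')
    then show "\<bar>pos' x u - pos' y u\<bar> \<le> \<delta>" using m by simp
  qed
  then have "\<forall>i\<le>j. good i S' p' pos'" using good' by (metis le_neq_implies_less)
  then show ?thesis using X sub' by blast
qed

lemma subdivides_init:
  assumes "init_fcx K pK = (S, p, pos)"
  shows "subdivides S p pos"
proof -
  have S: "S = (\<lambda>\<sigma>. Orig ` \<sigma>) ` K" and p: "\<And>v. p (Orig v) = pK v"
    and pos: "\<And>v. pos (Orig v) = (\<lambda>u. if u = v then 1 else 0)"
    using assms by (auto simp: init_fcx_def)
  have US: "\<exists>v\<in>\<Union>K. x = Orig v" if "x \<in> \<Union>S" for x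
    using that S by auto
  show ?thesis
    unfolding subdivides_def
  proof (intro conjI ballI)
    show "simplicial_complex S"
      unfolding simplicial_complex_def
    proof (intro conjI ballI allI impI)
      fix \<sigma>' assume "\<sigma>' \<in> S"
      then obtain \<sigma> where \<sigma>: "\<sigma> \<in> K" "\<sigma>' = Orig ` \<sigma>" unfolding S by blast
      show "finite \<sigma>'" "\<sigma>' \<noteq> {}"
        using simplicial_complexD(1,2)[OF K(1) \<sigma>(1)] \<sigma>(2) by simp_all
      fix \<tau>' assume \<tau>': "\<tau>' \<subseteq> \<sigma>' \<and> \<tau>' \<noteq> {}"
      then obtain \<tau> where \<tau>: "\<tau> \<subseteq> \<sigma>" "\<tau>' = Orig ` \<tau>"
        unfolding \<sigma>(2) by (meson subset_imageE)
      then have "\<tau> \<in> K" using \<tau>' by (intro simplicial_complexD(3)[OF K(1) \<sigma>(1)]) auto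
      then show "\<tau>' \<in> S" unfolding S \<tau>(2) by blast
    qed
    show "finite S" unfolding S using K(2) by simp
    fix \<sigma>' assume "\<sigma>' \<in> S"
    then obtain \<sigma> where \<sigma>: "\<sigma> \<in> K" "\<sigma>' = Orig ` \<sigma>" unfolding S by blast
    have "pos (Orig v) \<in> closed_simplex \<sigma>" if "v \<in> \<sigma>" for v
      using that simplicial_complexD(1)[OF K(1) \<sigma>(1)] by (auto simp: pos closed_simplex_def)
    then show "\<exists>\<rho>\<in>K. \<forall>x\<in>\<sigma>'. pos x \<in> closed_simplex \<rho>"
      using \<sigma> by blast
  next
    fix x assume "x \<in> \<Union>S"
    then obtain v where v: "x = Orig v" using US by blast
    have "supp (pos (Orig v)) = {v}" unfolding pos by auto
    then show "strat pK (pos x) = p x" unfolding v strat_def p by simp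
    show "p x = vertex_stratum pK x" unfolding v p by simp
  qed
qed

lemma ex_sd_Sigma:
  "\<exists>\<Sigma> S p pos. sd_Sigma \<Sigma> j (init_fcx K pK) = (S, p, pos) \<and> subdivides S p pos \<and>
     (\<forall>i\<le>j. good i S p pos)"
proof (induction j)
  case 0
  obtain S p pos where X: "init_fcx K pK = (S, p, pos)" by (rule prod_cases3)
  obtain m S' p' pos' where "((\<lambda>Y. sd_step Y {}) ^^ m) (S, p, pos) = (S', p', pos')"
    "subdivides S' p' pos'" "\<forall>i\<le>0. good i S' p' pos'"
    using ex_stage[OF subdivides_init[OF X], of "{}" 0] by auto
  then show ?case
    by (intro exI[of _ "\<lambda>_. m"] exI[of _ S'] exI[of _ p'] exI[of _ pos']) (simp add: X)
next
  case (Suc j)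
  then obtain \<Sigma> S p pos where X: "sd_Sigma \<Sigma> j (init_fcx K pK) = (S, p, pos)"
    and sub: "subdivides S p pos" and good: "\<forall>i\<le>j. good i S p pos"
    by blast
  \<comment> \<open>\<open>low_verts j\<close> includes stratum \<open>j\<close>, whereas the set
    \<open>A\<close> of stage \<open>Suc j\<close> is described by a strict inequality.\<close>
  have A: "low_verts j (S, p, pos) = {w \<in> \<Union>S. p w < Suc j}"
    by (simp add: low_verts_def less_Suc_eq_le)
  obtain m S' p' pos' where X': "((\<lambda>Y. sd_step Y (low_verts j (S, p, pos))) ^^ m) (S, p, pos) = (S', p', pos')"
    and sub': "subdivides S' p' pos'" and good': "\<forall>i\<le>Suc j. good i S' p' pos'"
    using ex_stage[OF sub A] good by (meson less_Suc_eq_le)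
  \<comment> \<open>Levels up to \<open>j\<close> do not read the entry \<open>Suc j\<close>, so it
    can be set once the complex of level \<open>j\<close> is known.\<close>
  have cong: "sd_Sigma (\<Sigma>(Suc j := m)) k Y = sd_Sigma \<Sigma> k Y" if "k \<le> j" for k Y
    using that by (induction k) simp_all
  have "sd_Sigma (\<Sigma>(Suc j := m)) (Suc j) (init_fcx K pK) = (S', p', pos')"
    by (simp add: cong X X')
  then show ?case using sub' good' by blast
qed

lemma ex_simplicial_approximation:
  assumes "finite L"
  shows "\<exists>\<Sigma> S p pos f. sd_Sigma \<Sigma> q (init_fcx K pK) = (S, p, pos) \<and>
     simplicial_map_strat S p L pL f \<and> strat_homotopic S p L pL (real_map f) (\<phi> \<circ> subdiv_homeo pos)"
proof -
  obtain \<Sigma> S p pos where X: "sd_Sigma \<Sigma> q (init_fcx K pK) = (S, p, pos)"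
    and sub: "subdivides S p pos" and good: "\<forall>i\<le>q. good i S p pos"
    using ex_sd_Sigma by blast
  have "\<exists>f. simplicial_map_strat S p L pL f \<and>
    strat_homotopic S p L pL (real_map f) (\<phi> \<circ> subdiv_homeo pos)"
    by (rule ex_approximation[OF sub _ assms]) (use good in simp)
  then show ?thesis using X by blast
qed

end

section \<open>Reduction to a finite target complex\<close>

lemma simplicial_map_strat_mono:
  "L' \<subseteq> L \<Longrightarrow> simplicial_map_strat S pS L' pL f \<Longrightarrow> simplicial_map_strat S pS L pL f"
  by (auto simp: simplicial_map_strat_def)

lemma strat_homotopic_mono:
  assumes "simplicial_complex L'" "simplicial_complex L" "L' \<subseteq> L"
    and "strat_homotopic S pS L' pL g0 g1"
  shows "strat_homotopic S pS L pL g0 g1"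
proof -
  obtain H where H: "continuous_map (prod_topology (realization_top S) (top_of_set {0..1::real}))
            (realization_top L') H"
    "\<forall>x\<in>realization S. \<forall>s\<in>{0..1::real}. strat pL (H (x, s)) = strat pS x"
    "\<forall>x\<in>realization S. H (x, 0) = g0 x \<and> H (x, 1) = g1 x"
    using assms(4) unfolding strat_homotopic_def by blast
  have "continuous_map (prod_topology (realization_top S) (top_of_set {0..1::real})) (realization_top L) H"
    using continuous_map_compose[OF H(1) continuous_map_realization_mono[OF assms(1-3)]]
    by (simp add: comp_def)
  then show ?thesis
    unfolding strat_homotopic_def using H(2,3) by (intro exI[of _ H]) simp
qed

theorem theorem1p4p10:
  fixes q :: nat
    and K :: "'v set set" and pK :: "'v \<Rightarrow> nat"
    and L :: "'u set set" and pL :: "'u \<Rightarrow> nat"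
    and \<phi> :: "('v \<Rightarrow> real) \<Rightarrow> ('u \<Rightarrow> real)"
  assumes "filtered_complex q K pK" and "finite K"
    and "filtered_complex q L pL"
    and "strat_map K pK L pL \<phi>"
  shows "\<exists>(\<Sigma> :: nat \<Rightarrow> nat) (f :: 'v sdv \<Rightarrow> 'u).
           (case sd_Sigma \<Sigma> q (init_fcx K pK) of (S, pS, posS) \<Rightarrow>
              simplicial_map_strat S pS L pL f \<and>
              strat_homotopic S pS L pL (real_map f) (\<phi> \<circ> subdiv_homeo posS))"
proof -
  have K: "simplicial_complex K" and pK: "\<And>v. v \<in> \<Union>K \<Longrightarrow> pK v \<le> q"
    using assms(1) unfolding filtered_complex_def by blast+
  have cL: "simplicial_complex L"
    using assms(3) by (simp add: filtered_complex_def)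
  have cont: "continuous_map (realization_top K) (realization_top L) \<phi>"
    and strat: "\<And>x. x \<in> realization K \<Longrightarrow> strat pL (\<phi> x) = strat pK x"
    using assms(4) by (simp_all add: strat_map_def)
  note phi = continuous_on_realization_map[OF K assms(2) cL cont]
  have phi_in: "\<phi> x \<in> realization L" if "x \<in> realization K" for x
    using phi(2) that by blast
  \<comment> \<open>The smallest subcomplex whose realization contains the image of
    \<open>\<phi>\<close>.\<close>
  define L' where "L' = {\<tau> \<in> L. \<exists>x\<in>realization K. \<tau> \<subseteq> supp (\<phi> x)}"
  have L'L: "L' \<subseteq> L" by (simp add: L'_def)
  have L': "simplicial_complex L'"
    unfolding simplicial_complex_def
  proof (intro conjI ballI allI impI)
    fix \<sigma> assume \<sigma>: "\<sigma> \<in> L'"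
    then have \<sigma>L: "\<sigma> \<in> L" using L'L by blast
    show "finite \<sigma>" "\<sigma> \<noteq> {}" using simplicial_complexD(1,2)[OF cL \<sigma>L] .
    obtain x where x: "x \<in> realization K" "\<sigma> \<subseteq> supp (\<phi> x)" using \<sigma> unfolding L'_def by blast
    fix \<tau> assume \<tau>: "\<tau> \<subseteq> \<sigma> \<and> \<tau> \<noteq> {}"
    then have "\<tau> \<in> L" by (intro simplicial_complexD(3)[OF cL \<sigma>L]) simp_all
    moreover have "\<tau> \<subseteq> supp (\<phi> x)" using \<tau> x(2) by (meson order_trans)
    ultimately show "\<tau> \<in> L'" unfolding L'_def using x(1) by blast
  qed
  \<comment> \<open>Compactness for the weak topology is essential: points on infinitely many edges
    at one vertex can converge to that vertex pointwise, so compactness for pointwise convergence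
    would not bound the number of supports.\<close>
  have "finite (supp ` \<phi> ` realization K)"
  proof (rule finite_supp_compactin[OF cL image_compactin[OF _ cont]])
    show "compactin (realization_top K) (realization K)"
      using compact_realization[OF K assms(2)]
      by (simp add: realization_top_finite[OF K assms(2)] compactin_subtopology)
  qed
  moreover have "finite (supp (\<phi> x))" if "x \<in> realization K" for x
    by (rule realization_finite_supp(1)[OF cL phi_in[OF that]])
  ultimately have "finite (\<Union>\<rho>\<in>supp ` \<phi> ` realization K. Pow \<rho>)"
    by (intro finite_UN_I) (auto simp only: finite_Pow_iff)
  moreover have "L' \<subseteq> (\<Union>\<rho>\<in>supp ` \<phi> ` realization K. Pow \<rho>)"
    unfolding L'_def by blast
  ultimately have finL': "finite L'" by (rule finite_subset[rotated])
  have phi_L': "\<phi> x \<in> realization L'" if x: "x \<in> realization K" for x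
  proof (rule realizationI)
    show "supp (\<phi> x) \<in> L'"
      unfolding L'_def using x realizationD(2)[OF phi_in[OF x]] by blast
  qed (rule realizationD[OF phi_in[OF x]])+
  interpret subdivision q K pK L' pL \<phi>
    by unfold_locales (fact K assms(2) L' pK phi(1) phi_L' strat)+
  obtain \<Sigma> S p pos f where X: "sd_Sigma \<Sigma> q (init_fcx K pK) = (S, p, pos)"
    and f: "simplicial_map_strat S p L' pL f"
      "strat_homotopic S p L' pL (real_map f) (\<phi> \<circ> subdiv_homeo pos)"
    using ex_simplicial_approximation[OF finL'] by blast
  show ?thesis
    using simplicial_map_strat_mono[OF L'L f(1)] strat_homotopic_mono[OF L' cL L'L f(2)]
    by (intro exI[of _ \<Sigma>] exI[of _ f]) (simp add: X)
qed

end
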